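(* Let $q$ be a prime power and $m$ a positive integer with $\gcd(q,m)=1$. For $f\in\mathbb{F}_q[x]$ let $C_f$ be the affine curve over $\mathbb{F}_q$ given by $y^m=f(x)$, and let $\mathbb{F}_q[x]_d$ denote the set of polynomials in $\mathbb{F}_q[x]$ of degree exactly $d$. Then for every integer $k$, $$ \lim_{d\to\infty} \frac{\#\{f\in \mathbb{F}_q[x]_d \mid C_f \text{ is smooth and has exactly } k \ \mathbb{F}_q\text{-points}\}}{\# \{f\in \mathbb{F}_q[x]_d \mid C_f \text{ is smooth}\}}= \Pr\Big(\sum_{i=1}^q X_i=k \Big), $$ where $X_1,\dots,X_q$ are independent identically distributed random variables with $$ X_{j}= \begin{cases} 0 & \text{with probability } \left(1-\frac{1}{(m,q-1)} \right)\frac{1}{1+q^{-1}}, \\ 1 & \text{with probability } \frac{q^{-1}}{1+q^{-1}}, \\ (m,q-1) & \text{with probability } \frac{1}{(m,q-1)} \frac{1}{1+q^{-1}}, \end{cases} $$ where, when $(m,q-1)=1$, the last two probabilities are added to give $\Pr(X_j=1)$. The same conclusion holds if, in both numerator and denominator, one additionally restricts to those $f$ for which $C_f$ is irreducible, or to those $f$ for which $C_f$ is geometrically irreducible.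
   Context: $(a,b)$ and $(a,b,c)$ denote greatest common divisors. The number of $\mathbb{F}_q$-points of $C_f$ is the number of pairs $(x,y)\in\mathbb{F}_q^2$ with $y^m=f(x)$. *)

theory Defs
  imports
    "HOL-Probability.Probability"
    "HOL-Computational_Algebra.Polynomial"
    "HOL-Algebra.Algebraic_Closure_Type"
begin

text \<open>
  A polynomial in \<open>k[x,y]\<close> is represented as a polynomial in \<open>y\<close> whose coefficients are
  polynomials in \<open>x\<close>.
\<close>

definition eval_xy :: "'a::comm_ring_1 poly poly \<Rightarrow> 'a \<Rightarrow> 'a \<Rightarrow> 'a" where
  "eval_xy F x y = poly (poly F [:y:]) x"

definition to_closure :: "'a::field poly poly \<Rightarrow> 'a alg_closure poly poly" where
  "to_closure F = map_poly (map_poly to_ac) F"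

definition geom_zeros :: "'a::field poly poly \<Rightarrow> ('a alg_closure \<times> 'a alg_closure) set" where
  "geom_zeros F = {(x, y). eval_xy (to_closure F) x y = 0}"

text \<open>
  Jacobian criterion at every geometric point of the affine plane curve \<open>F = 0\<close>.
  Here \<open>map_poly pderiv\<close> is the partial derivative with respect to \<open>x\<close>, and the outer
  \<open>pderiv\<close> is the one with respect to \<open>y\<close>.
\<close>

definition smooth_curve :: "'a::field poly poly \<Rightarrow> bool" where
  "smooth_curve F \<longleftrightarrow>
     (\<forall>(x, y) \<in> geom_zeros F.
        \<not> (eval_xy (to_closure (map_poly pderiv F)) x y = 0 \<and>
           eval_xy (to_closure (pderiv F)) x y = 0))"

text \<open>
  The \<open>k\<close>-Zariski topology on the points of the affine plane over the algebraic closure: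
  the equations defining a closed set have coefficients in \<open>k\<close> itself. The closed points of
  the scheme \<open>F = 0\<close> over \<open>k\<close> are the Galois orbits of such points, so the scheme is
  irreducible if and only if its set of geometric points is irreducible in this topology.
\<close>

definition zariski_closed :: "('a::field alg_closure \<times> 'a alg_closure) set \<Rightarrow> bool" where
  "zariski_closed Z \<longleftrightarrow> (\<exists>S :: 'a poly poly set. Z = (\<Inter>G\<in>S. geom_zeros G))"

definition irreducible_curve :: "'a::field poly poly \<Rightarrow> bool" where
  "irreducible_curve F \<longleftrightarrow>
     geom_zeros F \<noteq> {} \<and>
     (\<forall>A B. zariski_closed A \<and> zariski_closed B \<and> geom_zeros F = A \<union> B \<longrightarrow>
        geom_zeros F = A \<or> geom_zeros F = B)"

text \<open>
  Irreducibility after base change to the algebraic closure; on the right-hand side the base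
  field of the curve is \<open>'a alg_closure\<close>.
\<close>

definition geom_irreducible_curve :: "'a::field poly poly \<Rightarrow> bool" where
  "geom_irreducible_curve F \<longleftrightarrow> irreducible_curve (to_closure F)"

definition curve :: "nat \<Rightarrow> 'a::field poly \<Rightarrow> 'a poly poly" where
  "curve m f = Polynomial.monom 1 m - [:f:]"

lemma eval_xy_curve: "eval_xy (curve m f) x y = y ^ m - poly f x"
  by (simp add: eval_xy_def curve_def Polynomial.poly_monom)

definition num_points :: "nat \<Rightarrow> 'a::{field,finite} poly \<Rightarrow> nat" where
  "num_points m f = card {(x :: 'a, y :: 'a). y ^ m = poly f x}"

definition polys_of_degree :: "nat \<Rightarrow> 'a::zero poly set" where
  "polys_of_degree d = {f. f \<noteq> 0 \<and> Polynomial.degree f = d}"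

text \<open>
  The function \<open>pmf_of_list\<close> adds the weights of equal entries, so for \<open>gcd m (q - 1) = 1\<close>
  the last two weights both contribute to the value 1.
\<close>

definition fibre_pmf :: "nat \<Rightarrow> nat \<Rightarrow> nat pmf" where
  "fibre_pmf q m =
     (let r = gcd m (q - 1); s = inverse (real q) in
      pmf_of_list
        [(0, (1 - 1 / real r) * (1 / (1 + s))),
         (1, s / (1 + s)),
         (r, 1 / real r * (1 / (1 + s)))])"

text \<open>
  Outside its well-formedness condition \<open>pmf_of_list\<close> is unspecified; the weights above satisfy it.
\<close>

lemma fibre_pmf_wf:
  assumes "m > 0" "q > 0"
  defines "r \<equiv> gcd m (q - 1)" and "s \<equiv> inverse (real q)"
  shows "pmf_of_list_wf
        [(0 :: nat, (1 - 1 / real r) * (1 / (1 + s))),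
         (1, s / (1 + s)),
         (r, 1 / real r * (1 / (1 + s)))]"
proof (rule pmf_of_list_wfI)
  have r: "real r \<ge> 1" using assms(1) by (simp add: r_def Suc_le_eq)
  have s: "s > 0" using assms(2) by (simp add: s_def)
  show "sum_list (map snd [(0 :: nat, (1 - 1 / real r) * (1 / (1 + s))),
         (1, s / (1 + s)), (r, 1 / real r * (1 / (1 + s)))]) = 1"
    using add_divide_distrib[of 1 s "1 + s"] s by (simp add: diff_divide_distrib)
  fix x assume "x \<in> set (map snd [(0 :: nat, (1 - 1 / real r) * (1 / (1 + s))),
         (1, s / (1 + s)), (r, 1 / real r * (1 / (1 + s)))])"
  then show "x \<ge> 0" using r s by auto
qed

end

theory Submission
  imports Defs
begin

text \<open>
  Let \<open>m > 1\<close>. The curve \<open>y\<^sup>m = f(x)\<close> is smooth iff \<open>f\<close> is squarefree, and then it is geometrically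
  irreducible by Eisenstein's criterion at a root of \<open>f\<close>; so the three limits agree. Smoothness at
  the rational points and the number of points only depend on the jet \<open>c \<mapsto> (f c, f' c)\<close>, and
  writing \<open>f = g h\<^sup>2\<close> with \<open>h\<close> the largest square factor without rational roots expresses the
  (jet-independent) number of polynomials with a given jet through the numbers of those without
  such square factors. Inverting this relation shows that the latter numbers agree for any two
  jets up to \<open>O(\<rho> ^ d)\<close> with \<open>\<rho> < q\<close>, whereas their sum is at least of order \<open>q ^ d\<close>. Hence the
  jet of a random squarefree \<open>f\<close> becomes uniform among the jets that vanish nowhere, that is, its
  components become independent and uniform on the \<open>q\<^sup>2 - 1\<close> nonzero pairs. This product
  distribution is the one of the statement. The case \<open>m = 1\<close> is trivial.
\<close>

hide_const (open) up_ring.monom up_ring.coeff Coset.order Divisibility.irreducible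
  Polynomials.lead_coeff Polynomials.degree module.smult Divisibility.prime

section \<open>Polynomials over finite fields and their jets\<close>

text \<open>Two features make the jet the right invariant. A square factor with a rational root c
  forces a zero jet at c, so only squares of rootless polynomials have to be removed by counting.
  And multiplication by h^2 with h rootless acts bijectively on jets, because h(c) is invertible.
  This bijection depends on h, so the relation between the counts is no recursion for a single jet,
  and every estimate has to be uniform in the jet. Comparing two jets makes the total counts, which
  agree as soon as d is at least 2q, cancel; no asymptotic value of a count is computed. What
  remains bounds the difference in degree d by those in degrees d - 2j, with weight at most q^j for
  the choices of h.

  The law in the statement arises as follows. Of the q^2 - 1 nonzero pairs (f(c), f'(c)), q - 1 have
  f(c) = 0 and one point above c, a share of 1/(q + 1). In the other q(q - 1), f(c) is nonzero; with
  r = gcd(m, q - 1), one in r nonzero values is an m-th power, and it has r roots.\<close>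

definition monic_polys :: "nat \<Rightarrow> 'a::comm_semiring_1 poly set" where
  "monic_polys d = {h. lead_coeff h = 1 \<and> degree h = d}"

lemma polys_of_degree_0: "polys_of_degree 0 = (\<lambda>c. [:c:]) ` (UNIV - {0 :: 'a::zero})"
  by (auto simp: polys_of_degree_def elim!: degree_eq_zeroE)

lemma polys_of_degree_Suc:
  "polys_of_degree (Suc d) = (\<lambda>(c, p). pCons c p) ` (UNIV \<times> polys_of_degree d)"
  (is "?L = ?R")
proof (intro equalityI subsetI)
  fix f assume f: "f \<in> ?L"
  obtain c p where "f = pCons c p" by (cases f)
  with f show "f \<in> ?R"
    by (auto simp: polys_of_degree_def image_iff degree_pCons_eq_if split: if_splits)
qed (auto simp: polys_of_degree_def)

lemma finite_polys_of_degree [simp]: "finite (polys_of_degree d :: 'a::{zero,finite} poly set)"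
  by (induction d) (simp_all add: polys_of_degree_0 polys_of_degree_Suc)

lemma card_polys_of_degree:
  "card (polys_of_degree d :: 'a::{zero,finite} poly set) = (CARD('a) - 1) * CARD('a) ^ d"
proof (induction d)
  case 0
  have "inj (\<lambda>c::'a. [:c:])" by (auto intro: injI)
  then show ?case
    by (simp add: polys_of_degree_0 card_image inj_on_subset card_Diff_subset)
next
  case (Suc d)
  have "inj (\<lambda>(c::'a, p). pCons c p)" by (auto intro: injI)
  then show ?case
    by (simp add: polys_of_degree_Suc card_image inj_on_subset card_cartesian_product Suc)
qed

lemma monic_polys_0: "monic_polys 0 = {1 :: 'a::comm_semiring_1 poly}"
  by (auto simp: monic_polys_def one_pCons elim!: degree_eq_zeroE)

lemma monic_polys_Suc:
  "monic_polys (Suc d) \<subseteq> (\<lambda>(c, p). pCons c p) ` (UNIV \<times> monic_polys d)"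
proof
  fix f :: "'a poly" assume f: "f \<in> monic_polys (Suc d)"
  obtain c p where "f = pCons c p" by (cases f)
  with f show "f \<in> (\<lambda>(c, p). pCons c p) ` (UNIV \<times> monic_polys d)"
    by (auto simp: monic_polys_def image_iff degree_pCons_eq_if split: if_splits)
qed

lemma finite_monic_polys [simp]: "finite (monic_polys d :: 'a::{comm_semiring_1,finite} poly set)"
proof (induction d)
  case (Suc d)
  then show ?case by (intro finite_subset[OF monic_polys_Suc]) auto
qed (simp add: monic_polys_0)

lemma card_monic_polys_le:
  "card (monic_polys d :: 'a::{comm_semiring_1,finite} poly set) \<le> CARD('a) ^ d"
proof (induction d)
  case (Suc d)
  have "card (monic_polys (Suc d) :: 'a poly set)
      \<le> card ((\<lambda>(c, p). pCons c p) ` ((UNIV :: 'a set) \<times> monic_polys d))"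
    by (intro card_mono monic_polys_Suc) auto
  also have "\<dots> \<le> card ((UNIV :: 'a set) \<times> (monic_polys d :: 'a poly set))"
    by (intro card_image_le) auto
  also have "\<dots> \<le> CARD('a) ^ Suc d"
    using Suc by (simp add: card_cartesian_product)
  finally show ?case .
qed (simp add: monic_polys_0)

section \<open>Jets and Hermite interpolation at all rational points\<close>

definition jet :: "'a::idom poly \<Rightarrow> 'a \<Rightarrow> 'a \<times> 'a" where
  "jet f c = (poly f c, poly (pderiv f) c)"

lemma jet_add: "jet (f + g) c = jet f c + jet g c"
  by (simp add: jet_def pderiv_add)

lemma jet_sum: "jet (\<Sum>i\<in>I. f i) c = (\<Sum>i\<in>I. jet (f i) c)"
  by (induction I rule: infinite_finite_induct)
     (simp_all add: jet_add, simp_all add: jet_def zero_prod_def)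

text \<open>Multiplication by x permutes the nonzero elements, so their product absorbs the factor
  x^(q-1).\<close>

lemma finite_field_power_CARD_minus_1:
  fixes x :: "'a::{field,finite}"
  assumes "x \<noteq> 0"
  shows "x ^ (CARD('a) - 1) = 1"
proof -
  have "(\<lambda>y. x * y) ` (UNIV - {0}) = UNIV - {0}"
    using assms by (intro endo_inj_surj) (auto intro: inj_onI)
  moreover have "inj_on (\<lambda>y. x * y) (UNIV - {0})" using assms by (auto intro: inj_onI)
  ultimately have "(\<Prod>y\<in>UNIV - {0}. x * y) = \<Prod>(UNIV - {0})"
    by (metis (no_types, lifting) prod.reindex_cong)
  then have "x ^ (CARD('a) - 1) * \<Prod>(UNIV - {0 :: 'a}) = \<Prod>(UNIV - {0})"
    by (simp add: prod.distrib card_Diff_subset)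
  moreover have "\<Prod>(UNIV - {0 :: 'a}) \<noteq> 0" by simp
  ultimately show ?thesis by simp
qed

lemma CARD_field_ge_2: "CARD('a::{field,finite}) \<ge> 2"
  using card_mono[of "UNIV :: 'a set" "{0, 1}"] by simp

text \<open>The polynomial 1 - (X - c)^(q-1) is the indicator function of c. Its square has double
  zeros at all other points, so a linear factor can adjust the jet at c without affecting the
  others. The degree is at most 1 + 2(q - 1).\<close>

lemma hermite_interpolation:
  fixes J :: "'a::{field,finite} \<Rightarrow> 'a \<times> 'a"
  obtains A where "degree A < 2 * CARD('a)" "jet A = J"
proof -
  define e :: "'a \<Rightarrow> 'a poly" where "e c = 1 - [:-c, 1:] ^ (CARD('a) - 1)" for c
  have e_other: "poly (e c) x = (if x = c then 1 else 0)" for c x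
    using finite_field_power_CARD_minus_1[of "x - c"] CARD_field_ge_2[where 'a='a]
    by (simp add: e_def poly_power)
  have deg_e: "degree (e c) \<le> CARD('a) - 1" for c
    unfolding e_def by (intro degree_diff_le) (simp_all add: degree_power_eq)
  define b where "b c = poly (pderiv ((e c)\<^sup>2)) c" for c
  \<comment> \<open>With J c = (v, w), the linear factor is v + (w - b v)(X - c). Times the square,
    which has value 1 and derivative b at c, it has derivative (w - b v) + v b = w there.\<close>
  define a where "a c = [:fst (J c) - (snd (J c) - b c * fst (J c)) * c,
                     snd (J c) - b c * fst (J c):] * (e c)\<^sup>2" for c
  have e_sq: "poly (pderiv ((e c)\<^sup>2)) x = (if x = c then b c else 0)" for c x
    by (simp add: b_def power2_eq_square pderiv_mult e_other)
  have jet_a: "jet (a c) x = (if x = c then J c else 0)" for c x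
    unfolding jet_def a_def pderiv_mult poly_add poly_mult e_sq poly_power e_other
    by (simp add: pderiv_pCons prod_eq_iff algebra_simps)
  have "degree (a c) \<le> 2 * CARD('a) - 1" for c
  proof -
    have "degree (a c) \<le> 1 + degree ((e c)\<^sup>2)"
      unfolding a_def by (rule order_trans[OF degree_mult_le]) simp
    also have "degree ((e c)\<^sup>2) \<le> 2 * degree (e c)" using degree_power_le[of "e c" 2] by simp
    also note deg_e
    finally show ?thesis using CARD_field_ge_2[where 'a='a] by simp
  qed
  then have "degree (\<Sum>c\<in>UNIV. a c) \<le> 2 * CARD('a) - 1"
    by (intro degree_sum_le) auto
  moreover have "jet (\<Sum>c\<in>UNIV. a c) = J"
    by (rule ext) (simp add: jet_sum jet_a)
  ultimately show ?thesis
    using CARD_field_ge_2[where 'a='a] by (intro that) auto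
qed

text \<open>Translation by an interpolant of the difference of the jets is a bijection; the
  interpolant has degree below 2q, hence below d, and leaves the degree unchanged.\<close>

lemma card_polys_with_jet_eq:
  fixes J1 J2 :: "'a::{field,finite} \<Rightarrow> 'a \<times> 'a"
  assumes d: "d \<ge> 2 * CARD('a)"
  shows "card {f \<in> polys_of_degree d. jet f = J1} = card {f \<in> polys_of_degree d. jet f = J2}"
proof -
  obtain A where A: "degree A < 2 * CARD('a)" "jet A = (\<lambda>c. J2 c - J1 c)"
    by (rule hermite_interpolation)
  have jA: "jet (f + A) = J2" if "jet f = J1" for f
    using A(2) that by (intro ext) (simp add: jet_add)
  have jA': "jet (f - A) = J1" if "jet f = J2" for f
  proof
    fix c show "jet (f - A) c = J1 c"
      using jet_add[of "f - A" A c] A(2) that by (simp add: eq_diff_eq fun_eq_iff algebra_simps)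
  qed
  have deg: "f + A \<in> polys_of_degree d \<longleftrightarrow> f \<in> polys_of_degree d" for f
    using A d CARD_field_ge_2[where 'a='a] degree_add_eq_left[of A f] degree_add_eq_left[of "-A" "f + A"]
    by (auto simp: polys_of_degree_def)
  have "bij_betw (\<lambda>f. f + A) {f \<in> polys_of_degree d. jet f = J1} {f \<in> polys_of_degree d. jet f = J2}"
    by (rule bij_betw_byWitness[where f' = "\<lambda>f. f - A"])
       (use deg deg[of "_ - A"] jA jA' in auto)
  then show ?thesis by (rule bij_betw_same_card)
qed

section \<open>Extracting the rootless square factor\<close>

text \<open>A nonzero element of least degree in the ideal of a and b divides every element, since
  the remainder would be a smaller one.\<close>

lemma poly_bezout:
  fixes a b :: "'a::field poly"
  obtains e s t where "e dvd a" "e dvd b" "e = s * a + t * b"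
proof (cases "a = 0 \<and> b = 0")
  case True
  then show ?thesis using that[of 0 0 0] by simp
next
  case False
  define I where "I = {s * a + t * b | s t. True} - {0}"
  have "a \<in> I \<or> b \<in> I"
    using False unfolding I_def by (auto intro: exI[of _ 0] exI[of _ 1])
  then obtain e where e: "e \<in> I" "\<And>x. x \<in> I \<Longrightarrow> degree e \<le> degree x"
    using ex_has_least_nat[of "\<lambda>x. x \<in> I" _ degree] by blast
  then obtain s t where st: "e = s * a + t * b" "e \<noteq> 0" by (auto simp: I_def)
  have dvd: "e dvd u * a + v * b" for u v
  proof (rule ccontr)
    assume ndvd: "\<not> ?thesis"
    define x where "x = u * a + v * b"
    have "x mod e \<noteq> 0" using ndvd by (simp add: x_def dvd_eq_mod_eq_0)
    moreover have "x mod e = (u - (x div e) * s) * a + (v - (x div e) * t) * b"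
      using st(1) minus_div_mult_eq_mod[of x e] x_def by (simp add: algebra_simps)
    ultimately have "x mod e \<in> I" by (auto simp: I_def)
    from e(2)[OF this] show False
      using degree_mod_less[of e x] st(2) \<open>x mod e \<noteq> 0\<close> by linarith
  qed
  show ?thesis using that[of e s t] dvd[of 1 0] dvd[of 0 1] st(1) by simp
qed

definition rootless :: "'a::idom poly \<Rightarrow> bool" where
  "rootless h \<longleftrightarrow> (\<forall>c. poly h c \<noteq> 0)"

text \<open>The part of squarefreeness that jets do not see: if h has a rational root c, then h^2
  dividing f already forces \<open>jet f c = 0\<close>.\<close>

definition sqfree_off_points :: "'a::idom poly \<Rightarrow> bool" where
  "sqfree_off_points f \<longleftrightarrow> (\<forall>h. rootless h \<and> h\<^sup>2 dvd f \<longrightarrow> degree h = 0)"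

lemma rootless_nonzero: "rootless h \<Longrightarrow> h \<noteq> 0"
  by (auto simp: rootless_def)

lemma rootless_mult: "rootless (g * h) \<longleftrightarrow> rootless g \<and> rootless h"
  by (auto simp: rootless_def)

lemma rootless_degree_neq_1: "rootless (h :: 'a::field poly) \<Longrightarrow> degree h \<noteq> 1"
proof
  assume h: "rootless h" "degree h = 1"
  then obtain a b where "h = [:a, b:]" "b \<noteq> 0" using degree1_coeffs by blast
  then have "poly h (- a / b) = 0" by simp
  with h(1) show False by (auto simp: rootless_def)
qed

text \<open>Take h of maximal degree and make it monic; a rootless k with k^2 dividing the cofactor
  would give the larger candidate k h.\<close>

lemma exists_square_decomposition:
  fixes f :: "'a::field poly"
  assumes f: "f \<noteq> 0"
  shows "\<exists>g h. lead_coeff h = 1 \<and> rootless h \<and> f = g * h\<^sup>2 \<and> sqfree_off_points g"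
proof -
  let ?P = "\<lambda>h. rootless h \<and> h\<^sup>2 dvd f"
  have "degree h \<le> degree f" if "?P h" for h
  proof -
    have "degree (h\<^sup>2) \<le> degree f" using that f by (auto intro: dvd_imp_degree_le)
    then show ?thesis using rootless_nonzero[of h] that by (simp add: degree_power_eq)
  qed
  moreover have "?P 1" by (simp add: rootless_def)
  ultimately obtain h where h: "?P h" and max: "\<And>h'. ?P h' \<Longrightarrow> degree h' \<le> degree h"
    using ex_has_greatest_nat[of ?P 1 degree "Suc (degree f)"] by force
  define h0 where "h0 = Polynomial.smult (inverse (lead_coeff h)) h"
  have lc: "lead_coeff h \<noteq> 0" using rootless_nonzero h by auto
  have h0: "lead_coeff h0 = 1" "rootless h0"
    using lc h by (auto simp: h0_def rootless_def)
  have "h0\<^sup>2 dvd f" using h lc by (simp add: h0_def power2_eq_square smult_dvd_iff)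
  then obtain g where g: "f = g * h0\<^sup>2" by (metis dvdE mult.commute)
  have "sqfree_off_points g"
    unfolding sqfree_off_points_def
  proof (intro allI impI)
    fix k assume k: "rootless k \<and> k\<^sup>2 dvd g"
    then have "?P (k * h0)" using h0 unfolding g
      by (auto simp: rootless_mult power_mult_distrib intro!: mult_dvd_mono)
    from max[OF this] show "degree k = 0"
      using k h0 lc by (simp add: degree_mult_eq rootless_nonzero) (simp add: h0_def)
  qed
  with g h0 show ?thesis by blast
qed

lemma coprime_squares_mult_dvd:
  fixes a b x :: "'a::comm_ring_1"
  assumes "s * a + t * b = 1" "a\<^sup>2 dvd x" "b\<^sup>2 dvd x"
  shows "(a * b)\<^sup>2 dvd x"
proof -
  obtain u v where u: "x = a\<^sup>2 * u" and v: "x = b\<^sup>2 * v" using assms(2,3) by (metis dvdE)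
  \<comment> \<open>The cube is the least power in which every term contains a^2 or b^2. Each such
    term is then multiplied by x written as a multiple of the other square.\<close>
  have "x = x * (s * a + t * b) ^ 3" by (simp add: assms(1))
  also have "\<dots> = s\<^sup>2 * (s * a + 3 * t * b) * a\<^sup>2 * x + t\<^sup>2 * (t * b + 3 * s * a) * b\<^sup>2 * x"
    by (simp add: power3_eq_cube power2_eq_square algebra_simps)
  also have "\<dots> = s\<^sup>2 * (s * a + 3 * t * b) * a\<^sup>2 * (b\<^sup>2 * v) + t\<^sup>2 * (t * b + 3 * s * a) * b\<^sup>2 * (a\<^sup>2 * u)"
    using u v by simp
  also have "\<dots> = (a * b)\<^sup>2 * (s\<^sup>2 * (s * a + 3 * t * b) * v + t\<^sup>2 * (t * b + 3 * s * a) * u)"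
    by (simp add: power_mult_distrib algebra_simps)
  finally show ?thesis by (metis dvd_triv_left)
qed

text \<open>Cancel the common divisor e of k = e a and h = e b. Then a^2 divides g b^2 with a, b
  coprime, so a^2 divides g, which forces a to be constant.\<close>

lemma square_factor_dvd:
  fixes g h :: "'a::field poly"
  assumes g: "sqfree_off_points g" and h: "h \<noteq> 0" and k: "rootless k" "k\<^sup>2 dvd g * h\<^sup>2"
  shows "k dvd h"
proof -
  obtain e s t where e: "e dvd k" "e dvd h" "e = s * k + t * h" by (rule poly_bezout)
  have e0: "e \<noteq> 0" using e(2) h by auto
  obtain a b where a: "k = e * a" and b: "h = e * b" using e(1,2) by (metis dvdE)
  have "e * (s * a + t * b) = s * (e * a) + t * (e * b)" by (simp add: algebra_simps)
  also have "\<dots> = e * 1" using e(3) a b by simp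
  finally have "e * (s * a + t * b) = e * 1" .
  with e0 have ab: "s * a + t * b = 1" by (metis mult_cancel_left)
  have "e\<^sup>2 * a\<^sup>2 dvd e\<^sup>2 * (g * b\<^sup>2)"
    using k(2) by (simp add: a b power_mult_distrib mult_ac)
  then have "a\<^sup>2 dvd g * b\<^sup>2" using e0 by simp
  moreover have "b\<^sup>2 dvd g * b\<^sup>2" by simp
  ultimately have "(a * b)\<^sup>2 dvd g * b\<^sup>2" using ab by (intro coprime_squares_mult_dvd)
  moreover have "b \<noteq> 0" using b h by auto
  ultimately have "a\<^sup>2 dvd g" by (simp add: power_mult_distrib)
  moreover have "rootless a" using k(1) by (auto simp: a rootless_mult)
  ultimately have "degree a = 0" using g by (auto simp: sqfree_off_points_def)
  moreover have "a \<noteq> 0" using \<open>rootless a\<close> rootless_nonzero by blast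
  ultimately have "is_unit a" by (simp add: is_unit_iff_degree)
  then show ?thesis by (simp add: a e(2) mult_unit_dvd_iff)
qed

lemma square_decomposition_unique:
  fixes g1 g2 h1 h2 :: "'a::field poly"
  assumes "lead_coeff h1 = 1" "rootless h1" "sqfree_off_points g1"
    and "lead_coeff h2 = 1" "rootless h2" "sqfree_off_points g2"
    and eq: "g1 * h1\<^sup>2 = g2 * h2\<^sup>2"
  shows "h1 = h2" "g1 = g2"
proof -
  have nz: "h1 \<noteq> 0" "h2 \<noteq> 0" using assms rootless_nonzero by auto
  have "h1 dvd h2" using square_factor_dvd[of g2 h2 h1] assms nz by (metis dvd_triv_right)
  moreover have "h2 dvd h1" using square_factor_dvd[of g1 h1 h2] assms nz by (metis dvd_triv_right)
  ultimately obtain u where u: "h2 = h1 * u" "degree h1 = degree h2"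
    using nz by (metis dvdE dvd_imp_degree_le le_antisym)
  then have "degree u = 0" using nz by (auto simp: degree_mult_eq)
  moreover have "lead_coeff u = 1" using u assms(1,4) by (simp add: lead_coeff_mult)
  ultimately have "u = 1" by (auto simp: one_pCons elim!: degree_eq_zeroE)
  with u show "h1 = h2" by simp
  with eq nz show "g1 = g2" by simp
qed

section \<open>Equidistribution over jets\<close>

definition rootless_monics :: "nat \<Rightarrow> 'a::idom poly set" where
  "rootless_monics j = {h \<in> monic_polys j. rootless h}"

lemma finite_rootless_monics [simp]: "finite (rootless_monics j :: 'a::{field,finite} poly set)"
  by (simp add: rootless_monics_def)

lemma rootless_monics_0: "rootless_monics 0 = {1}"
  by (auto simp: rootless_monics_def monic_polys_0 rootless_def)

lemma rootless_monics_1: "rootless_monics (Suc 0) = ({} :: 'a::field poly set)"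
  using rootless_degree_neq_1 by (auto simp: rootless_monics_def monic_polys_def)

lemma card_rootless_monics_le:
  "card (rootless_monics j :: 'a::{field,finite} poly set) \<le> CARD('a) ^ j"
  by (rule order_trans[OF card_mono card_monic_polys_le]) (auto simp: rootless_monics_def)

definition sqfree_count :: "nat \<Rightarrow> ('a::{field,finite} \<Rightarrow> 'a \<times> 'a) \<Rightarrow> nat" where
  "sqfree_count d J = card {f \<in> polys_of_degree d. jet f = J \<and> sqfree_off_points f}"

text \<open>The inverse of the action (u, v) -> (u a^2, v a^2 + 2 u a b) on jets at c that
  multiplication by h^2 induces, where a = h(c) and b = h'(c).\<close>

definition jet_div_square :: "'a::field poly \<Rightarrow> ('a \<Rightarrow> 'a \<times> 'a) \<Rightarrow> 'a \<Rightarrow> 'a \<times> 'a" where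
  "jet_div_square h J c =
     (let a = poly h c; b = poly (pderiv h) c; u = fst (J c) / a\<^sup>2
      in (u, (snd (J c) - 2 * u * a * b) / a\<^sup>2))"

lemma jet_mult_square_iff:
  assumes "rootless h"
  shows "jet (g * h\<^sup>2) = J \<longleftrightarrow> jet g = jet_div_square h J"
proof -
  have "jet (g * h\<^sup>2) c = J c \<longleftrightarrow> jet g c = jet_div_square h J c" for c
  proof -
    define a b where "a = poly h c" and "b = poly (pderiv h) c"
    define g0 g1 where "g0 = poly g c" and "g1 = poly (pderiv g) c"
    have a: "a\<^sup>2 \<noteq> 0" using assms by (simp add: rootless_def a_def)
    have "poly (pderiv (g * h\<^sup>2)) c = g1 * a\<^sup>2 + 2 * g0 * a * b"
      by (simp add: pderiv_mult power2_eq_square a_def b_def g0_def g1_def algebra_simps)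
    then have "jet (g * h\<^sup>2) c = (g0 * a\<^sup>2, g1 * a\<^sup>2 + 2 * g0 * a * b)"
      by (simp add: jet_def a_def g0_def)
    then have "jet (g * h\<^sup>2) c = J c \<longleftrightarrow>
        g0 * a\<^sup>2 = fst (J c) \<and> g1 * a\<^sup>2 = snd (J c) - 2 * g0 * a * b"
      by (auto simp: prod_eq_iff eq_diff_eq)
    also have "\<dots> \<longleftrightarrow> g0 = fst (J c) / a\<^sup>2 \<and> g1 = (snd (J c) - 2 * g0 * a * b) / a\<^sup>2"
      using a by (simp add: nonzero_eq_divide_eq)
    also have "\<dots> \<longleftrightarrow> jet g c = jet_div_square h J c"
      by (auto simp: jet_def jet_div_square_def Let_def a_def b_def g0_def g1_def)
    finally show ?thesis .
  qed
  then show ?thesis by (simp add: fun_eq_iff)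
qed

lemma jet_div_square_1 [simp]: "jet_div_square 1 J = J"
  by (rule ext) (simp add: jet_div_square_def)

text \<open>Existence and uniqueness of f = g h^2 turn into a bijection, and the condition on the
  jet of f becomes one on g. With h = 1 split off, this is the relation to be inverted.\<close>

lemma card_polys_with_jet:
  fixes J :: "'a::{field,finite} \<Rightarrow> 'a \<times> 'a"
  shows "card {f \<in> polys_of_degree d. jet f = J} =
    (\<Sum>j\<le>d div 2. \<Sum>h\<in>rootless_monics j. sqfree_count (d - 2 * j) (jet_div_square h J))"
proof -
  define G where "G j h = {g \<in> polys_of_degree (d - 2 * j).
      jet g = jet_div_square h J \<and> sqfree_off_points g}" for j and h :: "'a poly"
  let ?D = "SIGMA j:{..d div 2}. SIGMA h:rootless_monics j. G j h"
  let ?\<phi> = "\<lambda>(j :: nat, h :: 'a poly, g). g * h\<^sup>2"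
  have fin: "finite (G j h)" for j h by (simp add: G_def)
  have inj: "inj_on ?\<phi> ?D"
  proof (rule inj_onI)
    fix x y assume xy: "x \<in> ?D" "y \<in> ?D" "?\<phi> x = ?\<phi> y"
    obtain j1 h1 g1 j2 h2 g2 where x: "x = (j1, h1, g1)" and y: "y = (j2, h2, g2)"
      by (cases x, cases y) auto
    have *: "h1 \<in> rootless_monics j1" "g1 \<in> G j1 h1" "h2 \<in> rootless_monics j2" "g2 \<in> G j2 h2"
      "g1 * h1\<^sup>2 = g2 * h2\<^sup>2"
      using xy by (simp_all add: x y)
    have 1: "lead_coeff h1 = 1" "rootless h1" "sqfree_off_points g1"
      and 2: "lead_coeff h2 = 1" "rootless h2" "sqfree_off_points g2"
      using * unfolding rootless_monics_def monic_polys_def G_def by blast+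
    note eq = square_decomposition_unique[OF 1 2 *(5)]
    have "j1 = j2" using * eq(1) by (auto simp: rootless_monics_def monic_polys_def)
    with eq show "x = y" by (simp add: x y)
  qed
  have img: "?\<phi> ` ?D = {f \<in> polys_of_degree d. jet f = J}"
  proof (intro equalityI subsetI)
    fix f assume "f \<in> ?\<phi> ` ?D"
    then obtain j h g where *: "j \<le> d div 2" "h \<in> rootless_monics j" "g \<in> G j h" "f = g * h\<^sup>2"
      by auto
    then have "degree h = j" "rootless h" by (auto simp: rootless_monics_def monic_polys_def)
    then show "f \<in> {f \<in> polys_of_degree d. jet f = J}"
      using * rootless_nonzero[of h]
      by (auto simp: G_def polys_of_degree_def jet_mult_square_iff degree_mult_eq degree_power_eq)
  next
    fix f assume f: "f \<in> {f \<in> polys_of_degree d. jet f = J}"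
    then obtain g h where *: "lead_coeff h = 1" "rootless h" "f = g * h\<^sup>2" "sqfree_off_points g"
      using exists_square_decomposition[of f] by (auto simp: polys_of_degree_def)
    have nz: "g \<noteq> 0" "h \<noteq> 0" using f * by (auto simp: polys_of_degree_def)
    have "d = degree g + 2 * degree h"
      using f * nz by (auto simp: polys_of_degree_def degree_mult_eq degree_power_eq)
    then have "(degree h, h, g) \<in> ?D" using * nz f
      by (auto simp: rootless_monics_def monic_polys_def G_def polys_of_degree_def jet_mult_square_iff)
    then show "f \<in> ?\<phi> ` ?D" by (rule rev_image_eqI) (simp add: *(3))
  qed
  have "card {f \<in> polys_of_degree d. jet f = J} = card ?D"
    unfolding img[symmetric] by (rule card_image[OF inj])
  also have "\<dots> = (\<Sum>j\<le>d div 2. \<Sum>h\<in>rootless_monics j. card (G j h))"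
    using fin by (subst card_SigmaI) (auto simp: card_SigmaI)
  finally show ?thesis by (simp add: G_def sqfree_count_def)
qed

lemma sum_power_from_2: "(1 - u) * (\<Sum>j=2..Suc n. u ^ j) = u\<^sup>2 - u ^ (n + 2)" for u :: real
proof (induction n)
  case (Suc n)
  have "(\<Sum>j=2..Suc (Suc n). u ^ j) = (\<Sum>j=2..Suc n. u ^ j) + u ^ (n + 2)"
    by (subst sum.cl_ivl_Suc) simp
  then have "(1 - u) * (\<Sum>j=2..Suc (Suc n). u ^ j) = (u\<^sup>2 - u ^ (n + 2)) + (1 - u) * u ^ (n + 2)"
    by (simp only: distrib_left Suc)
  also have "\<dots> = u\<^sup>2 - u ^ (Suc n + 2)" by (simp add: algebra_simps)
  finally show ?case .
qed (simp add: power2_eq_square)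

text \<open>The last assumption says that the infinite series u^2 / (1 - u) is at most b, with the
  denominator cleared.\<close>

lemma sum_power_from_2_le:
  fixes u :: real
  assumes "0 \<le> u" "u < 1" "u\<^sup>2 \<le> b * (1 - u)"
  shows "(\<Sum>j=2..n. u ^ j) \<le> b"
proof (cases n)
  case 0
  have "0 \<le> b * (1 - u)" using assms(3) by (rule order_trans[rotated]) simp
  with assms(2) 0 show ?thesis by (simp add: zero_le_mult_iff)
next
  case (Suc k)
  have "(1 - u) * (\<Sum>j=2..n. u ^ j) = u\<^sup>2 - u ^ (k + 2)"
    unfolding Suc by (rule sum_power_from_2)
  also have "\<dots> \<le> u\<^sup>2" using assms(1) by simp
  also have "\<dots> \<le> (1 - u) * b" using assms(3) by (simp only: mult.commute)
  finally have "(1 - u) * (\<Sum>j=2..n. u ^ j) \<le> (1 - u) * b" .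
  with assms(2) show ?thesis by simp
qed

text \<open>
  By induction on \<open>d\<close>, comparing the decompositions of both jets. The sum over the square factors
  starts at degree 2, as a linear polynomial has a root. The base \<open>\<rho>\<close> is chosen such that
  \<open>q / \<rho>\<^sup>2 = 3 / 5\<close>, whose powers from the second on sum to at most 1. A linear term would
  force \<open>q / \<rho>\<^sup>2 \<le> 1 / 2\<close>, which is not compatible with \<open>\<rho> < q\<close> when \<open>q = 2\<close>.
\<close>

lemma sqfree_count_diff_le:
  fixes J1 J2 :: "'a::{field,finite} \<Rightarrow> 'a \<times> 'a"
  defines "q \<equiv> real CARD('a)"
  defines "\<rho> \<equiv> sqrt (5 / 3 * q)"
  shows "\<bar>real (sqfree_count d J1) - real (sqfree_count d J2)\<bar> \<le> q ^ (2 * CARD('a)) * \<rho> ^ d"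
proof (induction d arbitrary: J1 J2 rule: less_induct)
  case (less d)
  have q2: "q \<ge> 2" using CARD_field_ge_2[where 'a='a] by (simp add: q_def)
  have \<rho>: "\<rho> \<ge> 1" "\<rho>\<^sup>2 = 5 / 3 * q" using q2 by (auto simp: \<rho>_def)
  let ?C = "q ^ (2 * CARD('a))"
  show ?case
  proof (cases "d \<ge> 2 * CARD('a)")
    \<comment> \<open>Translation does not apply in small degree. Both counts lie between 0 and
      q^(d+1), at most q^(2q), and this is where the constant \<open>?C\<close> comes from.\<close>
    case False
    have le: "real (sqfree_count d J) \<le> ?C" for J :: "'a \<Rightarrow> 'a \<times> 'a"
    proof -
      have "sqfree_count d J \<le> card (polys_of_degree d :: 'a poly set)"
        unfolding sqfree_count_def by (intro card_mono) auto
      also have "\<dots> \<le> CARD('a) ^ Suc d" by (simp add: card_polys_of_degree)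
      also have "\<dots> \<le> CARD('a) ^ (2 * CARD('a))"
        using False CARD_field_ge_2[where 'a='a] by (intro power_increasing) auto
      finally show ?thesis unfolding q_def by (simp flip: of_nat_power)
    qed
    have "\<bar>real (sqfree_count d J1) - real (sqfree_count d J2)\<bar> \<le> ?C"
      using le[of J1] le[of J2] by linarith
    also have "\<dots> \<le> ?C * \<rho> ^ d" using \<rho> q2 by (simp add: one_le_power)
    finally show ?thesis .
  next
    case True
    define E where "E h j = real (sqfree_count (d - 2 * j) (jet_div_square h J1))
      - real (sqfree_count (d - 2 * j) (jet_div_square h J2))" for h :: "'a poly" and j
    \<comment> \<open>The total counts for \<open>J1\<close> and \<open>J2\<close> agree, so the
      differences of their decompositions sum to zero.\<close>
    have "(\<Sum>j\<le>d div 2. \<Sum>h\<in>rootless_monics j. E h j) = 0"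
      using card_polys_with_jet_eq[OF True, of J1 J2, unfolded card_polys_with_jet]
      unfolding E_def sum_subtractf of_nat_sum[symmetric] right_minus_eq of_nat_eq_iff by blast
    moreover have "{..d div 2} = insert 0 (insert (Suc 0) {2..d div 2})"
    proof -
      have "d div 2 \<ge> 1" using True CARD_field_ge_2[where 'a='a] by linarith
      then show ?thesis by auto
    qed
    \<comment> \<open>Degree 0 contributes only h = 1, whose term is the difference to be bounded,
      and degree 1 contributes nothing.\<close>
    ultimately have "E 1 0 = - (\<Sum>j=2..d div 2. \<Sum>h\<in>rootless_monics j. E h j)"
      by (simp add: rootless_monics_0 rootless_monics_1)
    then have "\<bar>E 1 0\<bar> \<le> (\<Sum>j=2..d div 2. \<bar>\<Sum>h\<in>rootless_monics j. E h j\<bar>)"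
      by (simp add: sum_abs)
    also have "\<dots> \<le> (\<Sum>j=2..d div 2. ?C * \<rho> ^ d * (3 / 5) ^ j)"
    proof (intro sum_mono)
      fix j assume j: "j \<in> {2..d div 2}"
      \<comment> \<open>Dividing by h^2 changes both jets, so the induction hypothesis is used for
        arbitrary jets in degree d - 2j.\<close>
      have "\<bar>\<Sum>h\<in>rootless_monics j. E h j\<bar> \<le> (\<Sum>h\<in>(rootless_monics j :: 'a poly set). ?C * \<rho> ^ (d - 2 * j))"
        unfolding E_def using j
        by (intro order_trans[OF sum_abs] sum_mono less) auto
      also have "\<dots> = real (card (rootless_monics j :: 'a poly set)) * (?C * \<rho> ^ (d - 2 * j))" by simp
      also have "\<dots> \<le> q ^ j * (?C * \<rho> ^ (d - 2 * j))"
      proof (intro mult_right_mono)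
        show "real (card (rootless_monics j :: 'a poly set)) \<le> q ^ j"
          using card_rootless_monics_le[of j, where 'a='a] unfolding q_def
          by (simp flip: of_nat_power)
      qed (use q2 \<rho> in auto)
      also have "\<rho> ^ d = (5 / 3 * q) ^ j * \<rho> ^ (d - 2 * j)"
      proof -
        have "2 * j + (d - 2 * j) = d" using j by auto
        then have "\<rho> ^ d = (\<rho>\<^sup>2) ^ j * \<rho> ^ (d - 2 * j)"
          by (simp only: power_mult[symmetric] power_add[symmetric])
        then show ?thesis by (simp only: \<rho>(2))
      qed
      then have "q ^ j * (?C * \<rho> ^ (d - 2 * j)) = ?C * \<rho> ^ d * (3 / 5) ^ j"
        by (simp add: power_mult_distrib power_divide)
      finally show "\<bar>\<Sum>h\<in>rootless_monics j. E h j\<bar> \<le> ?C * \<rho> ^ d * (3 / 5) ^ j" .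
    qed
    also have "\<dots> = ?C * \<rho> ^ d * (\<Sum>j=2..d div 2. (3 / 5) ^ j)" by (simp add: sum_distrib_left)
    \<comment> \<open>(3/5)^2 / (1 - 3/5) = 9/10.\<close>
    also have "\<dots> \<le> ?C * \<rho> ^ d * 1"
      using q2 \<rho> by (intro mult_left_mono sum_power_from_2_le) (auto simp: power2_eq_square)
    finally show ?thesis by (simp add: E_def)
  qed
qed

text \<open>The offending k divides the h of the square decomposition, so h is nonconstant; being
  rootless, it has degree at least 2. This replaces k by a monic polynomial.\<close>

lemma not_sqfree_off_points_subset:
  "{f \<in> polys_of_degree d. \<not> sqfree_off_points f} \<subseteq>
    (\<Union>j\<in>{2..d div 2}. \<Union>h\<in>rootless_monics j. (\<lambda>g. g * h\<^sup>2) ` (polys_of_degree (d - 2 * j) :: 'a::field poly set))"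
proof
  fix f :: "'a poly" assume f: "f \<in> {f \<in> polys_of_degree d. \<not> sqfree_off_points f}"
  then have f0: "f \<noteq> 0" "degree f = d" by (auto simp: polys_of_degree_def)
  from f obtain k where k: "rootless k" "k\<^sup>2 dvd f" "degree k \<noteq> 0"
    by (auto simp: sqfree_off_points_def)
  obtain g h where gh: "lead_coeff h = 1" "rootless h" "f = g * h\<^sup>2" "sqfree_off_points g"
    using exists_square_decomposition[OF f0(1)] by blast
  have nz: "g \<noteq> 0" "h \<noteq> 0" using f0(1) gh(3) by auto
  have "k dvd h" by (rule square_factor_dvd[OF gh(4) nz(2) k(1)]) (use k(2) gh(3) in simp)
  then have "degree k \<le> degree h" using nz by (intro dvd_imp_degree_le)
  then have "degree h \<ge> 2" using k(3) rootless_degree_neq_1[OF gh(2)] by linarith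
  moreover have "d = degree g + 2 * degree h"
    unfolding f0(2)[symmetric] gh(3) using nz by (simp add: degree_mult_eq degree_power_eq)
  ultimately have "degree h \<in> {2..d div 2}" "h \<in> rootless_monics (degree h)"
      "g \<in> polys_of_degree (d - 2 * degree h)"
    using gh(1,2) nz(1) by (simp_all add: rootless_monics_def monic_polys_def polys_of_degree_def)
  with gh(3) show "f \<in> (\<Union>j\<in>{2..d div 2}. \<Union>h\<in>rootless_monics j. (\<lambda>g. g * h\<^sup>2) ` polys_of_degree (d - 2 * j))"
    by - (rule UN_I[of "degree h"], assumption, rule UN_I[of h], assumption, rule image_eqI[of _ _ g], assumption+)
qed

text \<open>A union bound: the share of polynomials divisible by h^2 for a rootless monic h of
  degree j is at most q^j q^(-2j), and the sum over j from 2 on is at most 1 / (q (q - 1)), hence at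
  most 1/2. Starting at degree 2 is essential for q = 2.\<close>

lemma sum_sqfree_count_ge:
  "(\<Sum>J\<in>(UNIV :: ('a::{field,finite} \<Rightarrow> 'a \<times> 'a) set). real (sqfree_count d J))
     \<ge> real (CARD('a) - 1) * real CARD('a) ^ d / 2"
proof -
  define q where "q = CARD('a)"
  have q2: "q \<ge> 2" using CARD_field_ge_2[where 'a='a] by (simp add: q_def)
  define P where "P = (polys_of_degree d :: 'a poly set)"
  define W where "W = {f \<in> P. sqfree_off_points f}"
  define V where "V = {f \<in> P. \<not> sqfree_off_points f}"
  have "real (card V) \<le> (\<Sum>j=2..d div 2. real (q - 1) * real q ^ d * (1 / q) ^ j)"
  proof -
    have "card V \<le> card (\<Union>j\<in>{2..d div 2}. \<Union>h\<in>rootless_monics j. (\<lambda>g. g * h\<^sup>2) ` (polys_of_degree (d - 2 * j) :: 'a poly set))"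
      unfolding V_def P_def by (intro card_mono not_sqfree_off_points_subset) auto
    also have "\<dots> \<le> (\<Sum>j=2..d div 2. card (\<Union>h\<in>rootless_monics j. (\<lambda>g. g * h\<^sup>2) ` (polys_of_degree (d - 2 * j) :: 'a poly set)))"
      by (intro card_UN_le) auto
    also have "\<dots> \<le> (\<Sum>j=2..d div 2. q ^ j * ((q - 1) * q ^ (d - 2 * j)))"
    proof (intro sum_mono)
      fix j
      have "card (\<Union>h\<in>rootless_monics j. (\<lambda>g. g * h\<^sup>2) ` (polys_of_degree (d - 2 * j) :: 'a poly set))
        \<le> (\<Sum>h\<in>(rootless_monics j :: 'a poly set). card ((\<lambda>g. g * h\<^sup>2) ` (polys_of_degree (d - 2 * j) :: 'a poly set)))"
        by (intro card_UN_le) auto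
      also have "\<dots> \<le> (\<Sum>h\<in>(rootless_monics j :: 'a poly set). (q - 1) * q ^ (d - 2 * j))"
        unfolding q_def card_polys_of_degree[symmetric] by (intro sum_mono card_image_le) auto
      also have "\<dots> \<le> q ^ j * ((q - 1) * q ^ (d - 2 * j))"
        using card_rootless_monics_le[of j, where 'a='a] by (simp add: q_def)
      finally show "card (\<Union>h\<in>rootless_monics j. (\<lambda>g. g * h\<^sup>2) ` (polys_of_degree (d - 2 * j) :: 'a poly set))
        \<le> q ^ j * ((q - 1) * q ^ (d - 2 * j))" .
    qed
    finally have "real (card V) \<le> real (\<Sum>j=2..d div 2. q ^ j * ((q - 1) * q ^ (d - 2 * j)))"
      by (rule of_nat_mono)
    also have "\<dots> = (\<Sum>j=2..d div 2. real (q - 1) * real q ^ d * (1 / q) ^ j)"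
      unfolding of_nat_sum
    proof (intro sum.cong refl)
      fix j assume "j \<in> {2..d div 2}"
      then have "j + j + (d - 2 * j) = d" by auto
      then have "real q ^ d = real q ^ j * real q ^ j * real q ^ (d - 2 * j)"
        by (simp only: power_add[symmetric])
      then show "real (q ^ j * ((q - 1) * q ^ (d - 2 * j))) = real (q - 1) * real q ^ d * (1 / q) ^ j"
        using q2 by (simp add: power_divide field_simps)
    qed
    finally show ?thesis .
  qed
  also have "\<dots> = real (q - 1) * real q ^ d * (\<Sum>j=2..d div 2. (1 / q) ^ j)" by (simp add: sum_distrib_left)
  also have "\<dots> \<le> real (q - 1) * real q ^ d * (1 / 2)"
  proof (intro mult_left_mono sum_power_from_2_le)
    have "2 \<le> real q * (real q - 1)" using q2 mult_mono[of 2 "real q" 1 "real q - 1"] by simp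
    then show "(1 / real q)\<^sup>2 \<le> 1 / 2 * (1 - 1 / real q)"
      using q2 by (simp add: power2_eq_square field_simps)
  qed (use q2 in auto)
  finally have V: "real (card V) \<le> real (q - 1) * real q ^ d * (1 / 2)" .
  have "card P = card W + card V"
    unfolding W_def V_def P_def by (subst card_Un_disjoint[symmetric]) (auto intro!: arg_cong[of _ _ card])
  moreover have "real (card P) = real (q - 1) * real q ^ d"
    by (simp add: P_def card_polys_of_degree q_def)
  ultimately have "real (card W) \<ge> real (q - 1) * real q ^ d / 2" using V by linarith
  moreover have "card W = (\<Sum>J\<in>(UNIV :: ('a \<Rightarrow> 'a \<times> 'a) set). sqfree_count d J)"
  proof -
    have "W = (\<Union>J\<in>UNIV. {f \<in> polys_of_degree d. jet f = J \<and> sqfree_off_points f})"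
      by (auto simp: W_def P_def)
    moreover have "card \<dots> = (\<Sum>J\<in>UNIV. card {f \<in> polys_of_degree d :: 'a poly set. jet f = J \<and> sqfree_off_points f})"
      by (rule card_UN_disjoint) auto
    ultimately show ?thesis by (simp add: sqfree_count_def)
  qed
  ultimately show ?thesis by (simp only: q_def of_nat_sum)
qed

text \<open>Each count differs from the mean \<open>s d\<close> over all jets by
  \<open>O(\<rho> ^ d)\<close>, while the mean is at least of order q^d. So every count divided by
  the mean tends to 1, and the sums over A and B just count jets.\<close>

lemma sqfree_count_ratio_tendsto:
  fixes A B :: "('a::{field,finite} \<Rightarrow> 'a \<times> 'a) set"
  assumes "B \<noteq> {}"
  shows "(\<lambda>d. (\<Sum>J\<in>A. real (sqfree_count d J)) / (\<Sum>J\<in>B. real (sqfree_count d J)))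
           \<longlonglongrightarrow> real (card A) / real (card B)"
proof -
  define q where "q = real CARD('a)"
  have q2: "q \<ge> 2" using CARD_field_ge_2[where 'a='a] by (simp add: q_def)
  define \<rho> where "\<rho> = sqrt (5 / 3 * q)"
  define C where "C = q ^ (2 * CARD('a))"
  define n where "n = real (card (UNIV :: ('a \<Rightarrow> 'a \<times> 'a) set))"
  have n: "n > 0" by (simp add: n_def card_gt_0_iff)
  define s where "s d = (\<Sum>J\<in>(UNIV :: ('a \<Rightarrow> 'a \<times> 'a) set). real (sqfree_count d J)) / n" for d
  define c where "c = (q - 1) / 2 / n"
  have c: "c > 0" using q2 n by (simp add: c_def)
  have s_ge: "s d \<ge> c * q ^ d" for d
  proof -
    have "(q - 1) * q ^ d / 2 / n \<le> s d"
      unfolding s_def using sum_sqfree_count_ge[of d, where 'a='a] n q2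
      by (intro divide_right_mono) (simp_all add: q_def of_nat_diff)
    then show ?thesis by (simp add: c_def field_simps)
  qed
  have s_pos: "s d > 0" for d
    using s_ge[of d] c q2 by (smt (verit) mult_pos_pos zero_less_power)
  have diff: "\<bar>real (sqfree_count d J) - s d\<bar> \<le> C * \<rho> ^ d" for d and J :: "'a \<Rightarrow> 'a \<times> 'a"
  proof -
    have "n * (real (sqfree_count d J) - s d) =
        (\<Sum>J'\<in>(UNIV :: ('a \<Rightarrow> 'a \<times> 'a) set). real (sqfree_count d J) - real (sqfree_count d J'))"
      using n by (simp add: sum_subtractf s_def n_def algebra_simps)
    also have "\<bar>\<dots>\<bar> \<le> (\<Sum>J'\<in>(UNIV :: ('a \<Rightarrow> 'a \<times> 'a) set). C * \<rho> ^ d)"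
      unfolding C_def \<rho>_def q_def by (intro order_trans[OF sum_abs] sum_mono sqfree_count_diff_le)
    also have "\<dots> = n * (C * \<rho> ^ d)" by (simp add: n_def)
    finally show ?thesis using n by (simp add: abs_mult)
  qed
  have lim: "(\<lambda>d. real (sqfree_count d J) / s d) \<longlonglongrightarrow> 1" for J :: "'a \<Rightarrow> 'a \<times> 'a"
  proof -
    \<comment> \<open>This amounts to 5/3 < q.\<close>
    have "\<bar>\<rho> / q\<bar> < 1"
    proof -
      have "\<rho> < sqrt (q * q)" unfolding \<rho>_def using q2 by (intro real_sqrt_less_mono) simp
      then show ?thesis using q2 by (simp add: \<rho>_def)
    qed
    then have "(\<lambda>d. C / c * (\<rho> / q) ^ d) \<longlonglongrightarrow> C / c * 0"
      by (intro tendsto_mult_left LIMSEQ_power_zero) simp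
    then have "(\<lambda>d. C / c * (\<rho> / q) ^ d) \<longlonglongrightarrow> 0" by simp
    moreover have "norm (real (sqfree_count d J) / s d - 1) \<le> C / c * (\<rho> / q) ^ d" for d
    proof -
      have "real (sqfree_count d J) / s d - 1 = (real (sqfree_count d J) - s d) / s d"
        using s_pos[of d] by (simp add: diff_divide_distrib)
      then have "norm (real (sqfree_count d J) / s d - 1) = \<bar>real (sqfree_count d J) - s d\<bar> / s d"
        using s_pos[of d] by (simp add: abs_divide)
      also have "\<dots> \<le> C * \<rho> ^ d / (c * q ^ d)"
        using s_ge[of d] diff[of d J] c q2 by (intro frac_le) auto
      finally show ?thesis by (simp add: power_divide)
    qed
    ultimately have "(\<lambda>d. real (sqfree_count d J) / s d - 1) \<longlonglongrightarrow> 0"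
      by (rule Lim_null_comparison[OF always_eventually[OF allI], rotated])
    then show ?thesis by (simp add: LIM_zero_iff)
  qed
  have "(\<lambda>d. (\<Sum>J\<in>A. real (sqfree_count d J) / s d) / (\<Sum>J\<in>B. real (sqfree_count d J) / s d))
           \<longlonglongrightarrow> (\<Sum>J\<in>A. 1) / (\<Sum>J\<in>B. 1)"
    using assms by (intro tendsto_divide tendsto_sum lim) (auto simp: card_eq_0_iff)
  moreover have "(\<Sum>J\<in>A. real (sqfree_count d J) / s d) / (\<Sum>J\<in>B. real (sqfree_count d J) / s d)
      = (\<Sum>J\<in>A. real (sqfree_count d J)) / (\<Sum>J\<in>B. real (sqfree_count d J))" for d
    using s_pos[of d] by (simp flip: sum_divide_distrib)
  ultimately show ?thesis by simp
qed

section \<open>Irreducibility of the curves\<close>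

abbreviation ac_poly :: "'a::field poly \<Rightarrow> 'a alg_closure poly" where
  "ac_poly \<equiv> map_poly to_ac"

lemma coeff_ac_poly [simp]: "coeff (ac_poly p) i = to_ac (coeff p i)"
  by (simp add: coeff_map_poly)

lemma ac_poly_add: "ac_poly (p + r) = ac_poly p + ac_poly r"
  by (intro poly_eqI) simp

lemma ac_poly_diff: "ac_poly (p - r) = ac_poly p - ac_poly r"
  by (intro poly_eqI) simp

lemma ac_poly_mult: "ac_poly (p * r) = ac_poly p * ac_poly r"
  by (intro poly_eqI) (simp add: coeff_mult to_ac_sum)

lemma ac_poly_power: "ac_poly (p ^ n) = ac_poly p ^ n"
  by (induction n) (simp_all add: ac_poly_mult)

lemma ac_poly_pderiv: "ac_poly (pderiv p) = pderiv (ac_poly p)"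
  by (intro poly_eqI) (simp add: coeff_pderiv)

lemma degree_ac_poly [simp]: "degree (ac_poly p) = degree p"
  by (simp add: degree_map_poly)

lemma ac_poly_eq_0_iff [simp]: "ac_poly p = 0 \<longleftrightarrow> p = 0"
  by (simp add: map_poly_eq_0_iff)

lemma poly_ac_poly_to_ac [simp]: "poly (ac_poly p) (to_ac x) = to_ac (poly p x)"
  by (induction p) (simp_all add: map_poly_pCons)

lemma coeff_to_closure [simp]: "coeff (to_closure F) i = ac_poly (coeff F i)"
  by (simp add: to_closure_def coeff_map_poly)

lemma to_closure_curve: "to_closure (curve m f) = curve m (ac_poly f)"
  by (intro poly_eqI) (simp add: curve_def ac_poly_diff coeff_pCons split: nat.splits)

lemma eval_xy_mult: "eval_xy (F * G) x y = eval_xy F x y * eval_xy G x y"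
  by (simp add: eval_xy_def)

lemma geom_zeros_curve: "geom_zeros (curve m f) = {(x, y). y ^ m = poly (ac_poly f) x}"
  by (simp add: geom_zeros_def to_closure_curve eval_xy_curve)

abbreviation specialize :: "'a::comm_ring_1 \<Rightarrow> 'a poly poly \<Rightarrow> 'a poly" where
  "specialize x \<equiv> map_poly (\<lambda>c. poly c x)"

lemma poly_specialize: "poly (specialize x R) y = eval_xy R x y"
  by (induction R) (simp_all add: eval_xy_def map_poly_pCons)

text \<open>Otherwise 1 plus the product of all X - c would be nonconstant without a root.\<close>

lemma infinite_UNIV_alg_closed: "infinite (UNIV :: 'a::alg_closed_field set)"
proof
  assume fin: "finite (UNIV :: 'a set)"
  define p where "p = (\<Prod>c\<in>UNIV. [:-c, 1:]) + (1 :: 'a poly)"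
  have "poly p x = 1" for x
  proof -
    have "(\<Prod>c\<in>UNIV. poly [:-c, 1:] x) = 0" using fin by (intro prod_zero) auto
    then show ?thesis by (simp add: p_def poly_prod)
  qed
  moreover have "degree (\<Prod>c\<in>UNIV. [:-c, 1 :: 'a:]) = card (UNIV :: 'a set)"
    by (subst degree_prod_eq_sum_degree) auto
  then have "degree p > 0" using fin
    by (simp add: p_def degree_add_eq_left card_gt_0_iff)
  ultimately show False using alg_closed_imp_poly_has_root[of p] by simp
qed

text \<open>The derivative m y^(m-1) vanishes only at 0, which is not a root of y^m - v; hence its m
  linear factors are distinct.\<close>

lemma card_nth_roots_alg_closed:
  fixes v :: "'a::alg_closed_field"
  assumes "of_nat m \<noteq> (0 :: 'a)" "v \<noteq> 0"
  shows "card {y. y ^ m = v} = m"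
proof -
  have m: "m > 0" using assms(1) by (cases m) auto
  define s where "s = monom 1 m - [:v:]"
  have deg: "degree s = m"
    unfolding s_def using m by (subst diff_conv_add_uminus, subst degree_add_eq_left) (simp_all add: degree_monom_eq)
  have lc: "lead_coeff s = 1"
    unfolding deg using m by (simp add: s_def coeff_pCons split: nat.splits)
  have poly_s: "poly s y = y ^ m - v" for y by (simp add: s_def poly_monom)
  have s0: "s \<noteq> 0" using deg m by auto
  obtain A where A: "size A = degree s" "s = Polynomial.smult (lead_coeff s) (\<Prod>x\<in>#A. [:-x, 1:])"
    using alg_closed_imp_factorization[OF s0] by blast
  have A': "s = (\<Prod>x\<in>#A. [:-x, 1:])" using A(2) by (simp add: lc)
  have roots: "{y. y ^ m = v} = set_mset A"
  proof -
    have "poly s y = 0 \<longleftrightarrow> y \<in># A" for y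
      unfolding A' by (simp add: poly_prod_mset prod_mset_zero_iff image_iff)
    then show ?thesis by (auto simp: poly_s)
  qed
  have "count A y = 1" if "y \<in># A" for y
  proof (rule ccontr)
    assume "count A y \<noteq> 1"
    with that have "count A y \<ge> 2"
      by (metis One_nat_def Suc_1 Suc_leI count_greater_zero_iff le_neq_implies_less)
    then have "replicate_mset 2 y \<subseteq># A" by (simp add: count_le_replicate_mset_subset_eq)
    then obtain B where "A = {#y, y#} + B"
      by (auto simp: numeral_2_eq_2 subset_mset.le_iff_add)
    then have "s = [:-y, 1:] * ([:-y, 1:] * (\<Prod>x\<in>#B. [:-x, 1:]))" using A' by simp
    then have "poly (pderiv s) y = 0" by (simp only: pderiv_mult poly_mult poly_add) simp
    moreover have "pderiv s = monom (of_nat m) (m - 1)"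
      by (simp add: s_def pderiv_diff pderiv_monom pderiv_pCons)
    ultimately have "y = 0" using assms(1) by (simp add: poly_monom)
    moreover have "y ^ m = v" using that roots by blast
    ultimately show False using assms(2) m by (auto simp: zero_power)
  qed
  then have "size A = card (set_mset A)"
    by (simp add: size_multiset_overloaded_eq)
  then show ?thesis using A(1) deg roots by simp
qed

lemma degree_curve: "m > 0 \<Longrightarrow> degree (curve m f) = m"
  unfolding curve_def
  by (subst diff_conv_add_uminus, subst degree_add_eq_left) (simp_all add: degree_monom_eq)

lemma lead_coeff_curve: "m > 0 \<Longrightarrow> lead_coeff (curve m f) = 1"
  unfolding degree_curve by (simp add: curve_def coeff_pCons split: nat.splits)

text \<open>A Nullstellensatz for this curve. The equation is monic in y, so pseudo-division is
  genuine division. Above each x with f(x) nonzero, the remainder of degree below m in y has m zeros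
  and therefore vanishes identically in y.\<close>

lemma curve_dvd_if_vanishes:
  fixes f :: "'a::alg_closed_field poly"
  assumes m: "of_nat m \<noteq> (0 :: 'a)" and f: "f \<noteq> 0"
    and van: "\<And>x y. y ^ m = poly f x \<Longrightarrow> eval_xy P x y = 0"
  shows "curve m f dvd P"
proof -
  have m0: "m > 0" using m by (cases m) auto
  have F0: "curve m f \<noteq> 0" using degree_curve[OF m0, of f] m0 by auto
  obtain Q R where QR: "pseudo_divmod P (curve m f) = (Q, R)" by fastforce
  have P: "P = curve m f * Q + R"
    using pseudo_divmod(1)[OF F0 QR] by (simp add: lead_coeff_curve[OF m0])
  have deg: "degree R < m"
    using pseudo_divmod(2)[OF F0 QR] m0 by (auto simp: degree_curve[OF m0])
  have R_van: "eval_xy R x y = 0" if "y ^ m = poly f x" for x y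
    using van[OF that] that eval_xy_curve[of m f x y]
    by (simp add: P eval_xy_def)
  have "coeff R i = 0" for i
  proof -
    \<comment> \<open>The factor f takes care of the points x with f(x) = 0, where fewer than m
      roots may be available.\<close>
    have "poly (coeff R i * f) x = 0" for x
    proof (cases "poly f x = 0")
      case False
      have "specialize x R = 0"
      proof (rule ccontr)
        assume nz: "specialize x R \<noteq> 0"
        have "card {y. y ^ m = poly f x} \<le> card {y. poly (specialize x R) y = 0}"
          using R_van nz by (intro card_mono poly_roots_finite) (auto simp: poly_specialize)
        also have "\<dots> \<le> degree (specialize x R)" using nz by (rule card_poly_roots_bound)
        also have "\<dots> \<le> degree R" by (rule map_poly_degree_leq)
        finally show False using deg card_nth_roots_alg_closed[OF m False] by simp
      qed
      then have "poly (coeff R i) x = 0"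
        by (metis (no_types, lifting) coeff_0 coeff_map_poly poly_0)
      then show ?thesis by simp
    qed simp
    then have "{x. poly (coeff R i * f) x = 0} = UNIV" by blast
    then have "coeff R i * f = 0"
      using poly_roots_finite infinite_UNIV_alg_closed by metis
    then show ?thesis using f by simp
  qed
  then have "R = 0" by (intro poly_eqI) simp
  then show ?thesis using P by simp
qed

text \<open>
  Eisenstein's criterion at \<open>\<alpha>\<close>: both factors specialize to divisors of \<open>y\<^sup>m\<close>, so both constant
  coefficients vanish at \<open>\<alpha>\<close>.
\<close>

lemma irreducible_curve_poly:
  fixes f :: "'a::alg_closed_field poly"
  assumes m: "m > 0" and \<alpha>: "poly f \<alpha> = 0" "m = 1 \<or> poly (pderiv f) \<alpha> \<noteq> 0"
  shows "irreducible (curve m f)"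
proof (rule Factorial_Ring.irreducibleI)
  show "curve m f \<noteq> 0" using degree_curve[OF m, of f] m by auto
  show "\<not> is_unit (curve m f)"
    using degree_curve[OF m, of f] m by (auto elim!: is_unit_polyE simp: degree_pCons_eq_if)
  fix P Q assume PQ: "curve m f = P * Q"
  have lc: "lead_coeff P * lead_coeff Q = 1"
    using lead_coeff_curve[OF m, of f] by (simp add: PQ lead_coeff_mult)
  have nz: "P \<noteq> 0" "Q \<noteq> 0" using lc by auto
  have unit: "is_unit p" if "is_unit (lead_coeff p)" "degree p = 0" for p :: "'a poly poly"
  proof -
    have "\<exists>a. p = [:a:]" using that(2) by (auto elim!: degree_eq_zeroE)
    then obtain a where a: "p = [:a:]" by blast
    have "is_unit a" using that(1) by (simp add: a)
    then obtain b where "1 = a * b" by (auto elim: dvdE)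
    then have "1 = p * [:b:]" by (simp add: a one_pCons)
    then show ?thesis by (rule dvdI)
  qed
  have units: "is_unit (lead_coeff P)" "is_unit (lead_coeff Q)"
    using lc by (metis dvd_triv_left, metis dvd_triv_right)
  show "is_unit P \<or> is_unit Q"
  proof (rule ccontr)
    assume "\<not> ?thesis"
    then have "degree P \<noteq> 0" "degree Q \<noteq> 0" using unit[of P] unit[of Q] units by blast+
    then have deg: "degree P > 0" "degree Q > 0" by simp_all
    have "degree P + degree Q = m"
      using degree_curve[OF m, of f] nz by (simp add: PQ degree_mult_eq)
    \<comment> \<open>Two factors of positive degree give m at least 2, which leaves only the second
      alternative of the assumption.\<close>
    then have der: "poly (pderiv f) \<alpha> \<noteq> 0" using deg \<alpha>(2) by linarith
    have eval: "poly (specialize \<alpha> P) y * poly (specialize \<alpha> Q) y = y ^ m" for y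
      using eval_xy_curve[of m f \<alpha> y] \<alpha>(1) by (simp add: PQ eval_xy_mult poly_specialize)
    have root: "poly (coeff p 0) \<alpha> = 0"
      if p: "degree p > 0" "is_unit (lead_coeff p)" "\<And>y. poly (specialize \<alpha> p) y = 0 \<Longrightarrow> y ^ m = 0"
      for p
    proof -
      \<comment> \<open>A unit is a nonzero constant, so specializing x keeps the degree in y
        positive, and a root exists.\<close>
      have "poly (lead_coeff p) \<alpha> \<noteq> 0" using p(2) by (auto elim!: is_unit_polyE)
      then have "degree (specialize \<alpha> p) > 0" using p(1) by (subst map_poly_degree_eq) auto
      then obtain y where y: "poly (specialize \<alpha> p) y = 0"
        using alg_closed_imp_poly_has_root by blast
      with p(3) m have "y = 0" by simp
      with y show ?thesis by (simp add: poly_0_coeff_0 coeff_map_poly)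
    qed
    have "poly (coeff P 0) \<alpha> = 0" "poly (coeff Q 0) \<alpha> = 0"
      using eval by (auto intro!: root deg units) (metis mult_zero_left mult_zero_right power_eq_0_iff)+
    \<comment> \<open>As a product of two polynomials vanishing at \<alpha>, f has a double zero
      there.\<close>
    moreover have "f = - (coeff P 0 * coeff Q 0)"
      using m arg_cong[OF PQ, of "\<lambda>p. coeff p 0"] by (simp add: curve_def coeff_mult_0 minus_equation_iff eq_commute[of f])
    ultimately have "poly (pderiv f) \<alpha> = 0" by (simp add: pderiv_minus pderiv_mult)
    with der show False ..
  qed
qed

text \<open>Two proper closed pieces lie in zero sets of G and H, neither containing the curve.
  Their product vanishes on the curve, so the equation, a prime element over the closure, divides G
  or H. Separability is stated as an identity because identities survive base change.\<close>

lemma irreducible_curve_curve: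
  fixes f :: "'a::field poly"
  assumes m: "of_nat m \<noteq> (0 :: 'a)" and deg: "degree f > 0"
    and sep: "m = 1 \<or> s * f + t * pderiv f = 1"
  shows "irreducible_curve (curve m f)"
proof -
  define g where "g = ac_poly f"
  have m0: "m > 0" using m by (cases m) auto
  have mL: "of_nat m \<noteq> (0 :: 'a alg_closure)" using m to_ac_eq_0_iff[of "of_nat m :: 'a"] by simp
  have "degree g > 0" using deg by (simp add: g_def)
  then obtain \<alpha> where \<alpha>: "poly g \<alpha> = 0" using alg_closed_imp_poly_has_root by blast
  have g0: "g \<noteq> 0" using \<open>degree g > 0\<close> by auto
  have "m = 1 \<or> poly (pderiv g) \<alpha> \<noteq> 0"
  proof (cases "m = 1")
    case False
    then have "ac_poly (s * f + t * pderiv f) = 1" using sep by simp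
    then have "poly (ac_poly s * g + ac_poly t * pderiv g) \<alpha> = 1"
      by (simp only: ac_poly_add ac_poly_mult ac_poly_pderiv g_def poly_1)
    then show ?thesis using \<alpha> by auto
  qed simp
  with m0 \<alpha> have "irreducible (curve m g)" by (intro irreducible_curve_poly)
  then have prime: "prime_elem (curve m g)" by (rule irreducible_imp_prime_elem)
  let ?Z = "geom_zeros (curve m f)"
  have Z: "?Z = {(x, y). y ^ m = poly g x}" by (simp add: geom_zeros_curve g_def)
  have vanish: "eval_xy P x y = 0" if "curve m g dvd P" "(x, y) \<in> ?Z" for P x y
    using that eval_xy_curve[of m g x y] by (auto simp: Z eval_xy_mult elim!: dvdE)
  show ?thesis
    unfolding irreducible_curve_def
  proof (intro conjI allI impI)
    have "(\<alpha>, 0) \<in> ?Z" using \<alpha> m0 by (simp add: Z)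
    then show "?Z \<noteq> {}" by blast
    fix A B assume AB: "zariski_closed A \<and> zariski_closed B \<and> ?Z = A \<union> B"
    have witness: "\<exists>G. A' \<subseteq> geom_zeros G \<and> \<not> ?Z \<subseteq> geom_zeros G"
      if A': "zariski_closed A'" "A' \<subseteq> ?Z" "?Z \<noteq> A'" for A'
    proof -
      obtain S where S: "A' = (\<Inter>G\<in>S. geom_zeros G)" using A'(1) by (auto simp: zariski_closed_def)
      obtain z where "z \<in> ?Z" "z \<notin> A'" using A' by blast
      then obtain G where "G \<in> S" "z \<notin> geom_zeros G" using S by blast
      with S \<open>z \<in> ?Z\<close> show ?thesis by blast
    qed
    show "?Z = A \<or> ?Z = B"
    proof (rule ccontr)
      assume "\<not> ?thesis"
      then obtain G H where G: "A \<subseteq> geom_zeros G" "\<not> ?Z \<subseteq> geom_zeros G"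
        and H: "B \<subseteq> geom_zeros H" "\<not> ?Z \<subseteq> geom_zeros H"
        using AB witness[of A] witness[of B] by blast
      have "eval_xy (to_closure G * to_closure H) x y = 0" if "y ^ m = poly g x" for x y
      proof -
        have "(x, y) \<in> geom_zeros G \<union> geom_zeros H" using that AB G H Z by blast
        then show ?thesis by (auto simp: geom_zeros_def eval_xy_mult)
      qed
      then have "curve m g dvd to_closure G * to_closure H"
        using mL g0 by (intro curve_dvd_if_vanishes) auto
      then have "curve m g dvd to_closure G \<or> curve m g dvd to_closure H"
        using prime by (simp add: prime_elem_dvd_mult_iff)
      then show False using vanish G(2) H(2) by (auto simp: geom_zeros_def)
    qed
  qed
qed

text \<open>The preceding lemma with \<open>'a alg_closure\<close> as base field, after transporting
  the Bezout identity.\<close>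

lemma geom_irreducible_curve_curve:
  fixes f :: "'a::field poly"
  assumes m: "of_nat m \<noteq> (0 :: 'a)" and deg: "degree f > 0"
    and sep: "m = 1 \<or> s * f + t * pderiv f = 1"
  shows "geom_irreducible_curve (curve m f)"
proof -
  have "m = 1 \<or> ac_poly s * ac_poly f + ac_poly t * pderiv (ac_poly f) = 1"
    using sep by (auto simp flip: ac_poly_mult ac_poly_add ac_poly_pderiv)
  moreover have "of_nat m \<noteq> (0 :: 'a alg_closure)"
    using m to_ac_eq_0_iff[of "of_nat m :: 'a"] by simp
  ultimately show ?thesis
    using deg unfolding geom_irreducible_curve_def to_closure_curve
    by (intro irreducible_curve_curve) auto
qed

section \<open>Smoothness\<close>

lemma prime_CHAR_finite_field: "prime (CHAR('a::{field,finite}))"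
  by (intro prime_CHAR_semidom finite_imp_CHAR_pos) simp

text \<open>Frobenius is additive with trivial kernel, hence injective, hence surjective on a finite
  field.\<close>

lemma exists_frobenius_root:
  fixes a :: "'a::{field,finite}"
  shows "\<exists>b. b ^ CHAR('a) = a"
proof -
  note pr = prime_CHAR_finite_field[where 'a='a]
  have "inj (\<lambda>b :: 'a. b ^ CHAR('a))"
  proof (rule injI)
    fix x y :: 'a assume "x ^ CHAR('a) = y ^ CHAR('a)"
    then have "((x - y) + y) ^ CHAR('a) = y ^ CHAR('a)" by simp
    then have "(x - y) ^ CHAR('a) = 0"
      unfolding freshmans_dream[OF pr refl] by simp
    then show "x = y" by simp
  qed
  then have "surj (\<lambda>b :: 'a. b ^ CHAR('a))" by (intro finite_UNIV_inj_surj) auto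
  then show ?thesis by (metis surjD)
qed

text \<open>Only exponents divisible by the characteristic l occur, since n times the n-th
  coefficient is zero. Taking l-th roots of the coefficients gives the root of p, because Frobenius
  is additive on polynomials.\<close>

lemma pderiv_0_imp_CHAR_power:
  fixes p :: "'a::{field,finite} poly"
  assumes "pderiv p = 0"
  obtains r where "p = r ^ CHAR('a)"
proof -
  define l where "l = CHAR('a)"
  have pr: "prime l"
    unfolding l_def by (rule prime_CHAR_finite_field)
  then have l: "l > 0" by (simp add: prime_gt_0_nat)
  have "\<exists>b. \<forall>i. b i ^ l = coeff p (i * l)"
    by (intro choice) (simp add: exists_frobenius_root l_def)
  then obtain b where b: "\<And>i. b i ^ l = coeff p (i * l)" by blast
  \<comment> \<open>Indices up to \<open>degree p\<close> certainly suffice; if i l exceeds the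
    degree, the term is zero.\<close>
  define r where "r = (\<Sum>i\<le>degree p. monom (b i) i)"
  have "r ^ l = (\<Sum>i\<le>degree p. monom (b i) i ^ l)"
    unfolding r_def using pr by (intro freshmans_dream_sum) (simp_all add: l_def)
  also have "\<dots> = (\<Sum>i\<le>degree p. monom (coeff p (i * l)) (i * l))"
    by (simp add: monom_power b)
  also have "\<dots> = p"
  proof (rule poly_eqI)
    fix n
    have "coeff (\<Sum>i\<le>degree p. monom (coeff p (i * l)) (i * l)) n
        = (\<Sum>i\<le>degree p. if i * l = n then coeff p n else 0)"
      by (auto simp: coeff_sum intro!: sum.cong)
    also have "\<dots> = coeff p n"
    proof (cases "l dvd n")
      case True
      then obtain i where i: "n = i * l" by (metis dvdE mult.commute)
      have "(\<Sum>j\<le>degree p. if j * l = n then coeff p n else 0) = (\<Sum>j\<le>degree p. if j = i then coeff p n else 0)"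
        using l by (simp add: i)
      also have "\<dots> = coeff p n"
      proof (cases "i \<le> degree p")
        case False
        moreover have "i \<le> n" using i l by simp
        ultimately show ?thesis by (simp add: coeff_eq_0)
      qed simp
      finally show ?thesis .
    next
      case False
      then obtain k where k: "n = Suc k" by (cases n) auto
      have "of_nat n * coeff p n = 0"
        using arg_cong[OF assms, of "\<lambda>p. coeff p k"] by (simp add: coeff_pderiv k)
      moreover have "of_nat n \<noteq> (0 :: 'a)" using False by (simp add: of_nat_eq_0_iff_char_dvd l_def)
      ultimately have "coeff p n = 0" by simp
      then show ?thesis by (simp cong: if_cong)
    qed
    finally show "coeff (\<Sum>i\<le>degree p. monom (coeff p (i * l)) (i * l)) n = coeff p n" .
  qed
  finally show ?thesis using that unfolding l_def by metis
qed

lemma exists_irreducible_factor: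
  fixes e :: "'a::field poly"
  assumes "degree e > 0"
  obtains p where "p dvd e" "Factorial_Ring.irreducible p"
proof -
  obtain p where p: "p dvd e" "degree p > 0"
    and min: "\<And>r. r dvd e \<Longrightarrow> degree r > 0 \<Longrightarrow> degree p \<le> degree r"
    using ex_has_least_nat[of "\<lambda>p. p dvd e \<and> degree p > 0" e degree] assms by auto
  have p0: "p \<noteq> 0" using p(2) by auto
  have "Factorial_Ring.irreducible p"
  proof (rule Factorial_Ring.irreducibleI)
    show "\<not> is_unit p" using p(2) p0 by (simp add: is_unit_iff_degree)
    fix a b assume ab: "p = a * b"
    then have nz: "a \<noteq> 0" "b \<noteq> 0" using p0 by auto
    have "degree p = degree a + degree b" using ab nz by (simp add: degree_mult_eq)
    moreover have "a dvd e" "b dvd e" using p(1) ab by (auto intro: dvd_trans)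
    ultimately have "degree a = 0 \<or> degree b = 0" using min[of a] min[of b] by linarith
    then show "is_unit a \<or> is_unit b" using nz by (simp add: is_unit_iff_degree)
  qed (rule p0)
  with p(1) show ?thesis by (rule that)
qed

text \<open>For an irreducible factor p of e and f = p u, p divides p' u. If p divides u, then p^2
  divides f. If p divides p', then p' = 0 by degree, so p is a power with exponent at least
  2.\<close>

lemma common_factor_pderiv_imp_square_factor:
  fixes f :: "'a::{field,finite} poly"
  assumes e: "e dvd f" "e dvd pderiv f" "degree e > 0"
  obtains h where "degree h > 0" "h\<^sup>2 dvd f"
proof -
  obtain p where p: "p dvd e" "Factorial_Ring.irreducible p"
    using e(3) by (rule exists_irreducible_factor)
  have prime: "prime_elem p" using p(2) by (rule field_poly_irreducible_imp_prime)
  have deg: "degree p > 0"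
    using p(2) by (auto simp: Factorial_Ring.irreducible_def is_unit_iff_degree)
  obtain u where u: "f = p * u" using dvd_trans[OF p(1) e(1)] by (rule dvdE)
  have "p dvd pderiv p * u"
    using dvd_trans[OF p(1) e(2)] by (simp add: u pderiv_mult dvd_add_right_iff mult.commute)
  then have "p dvd pderiv p \<or> p dvd u" using prime by (simp add: prime_elem_dvd_mult_iff)
  then show ?thesis
  proof
    assume "p dvd u"
    then have "p\<^sup>2 dvd f" by (simp add: u power2_eq_square mult_dvd_mono)
    with deg show ?thesis by (rule that)
  next
    assume "p dvd pderiv p"
    have "pderiv p = 0"
    proof (rule ccontr)
      assume "pderiv p \<noteq> 0"
      with \<open>p dvd pderiv p\<close> have "degree p \<le> degree (pderiv p)" by (intro dvd_imp_degree_le)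
      also have "\<dots> \<le> degree p - 1" by (rule degree_le) (auto simp: coeff_pderiv coeff_eq_0)
      finally show False using deg by simp
    qed
    then obtain r where r: "p = r ^ CHAR('a)" by (rule pderiv_0_imp_CHAR_power)
    have ge2: "CHAR('a) \<ge> 2" by (rule prime_ge_2_nat[OF prime_CHAR_finite_field])
    have "degree r > 0" using deg degree_power_le[of r "CHAR('a)"] unfolding r by (cases "degree r") auto
    moreover have "r\<^sup>2 dvd f"
      using le_imp_power_dvd[OF ge2, of r] unfolding u r by (rule dvd_mult2)
    ultimately show ?thesis by (rule that)
  qed
qed

lemma square_dvd_imp_pderiv_root:
  fixes f :: "'a::idom poly"
  assumes "h\<^sup>2 dvd f" "poly h x = 0"
  shows "poly f x = 0" "poly (pderiv f) x = 0"
  using assms by (auto elim!: dvdE simp: power2_eq_square pderiv_mult)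

text \<open>The partial derivatives are -f'(x) and m y^(m-1). The second is a nonzero constant for m
  = 1; otherwise it vanishes exactly at y = 0, where a point of the curve is a root of f.\<close>

lemma smooth_curve_curve_iff:
  fixes f :: "'a::field poly"
  assumes m: "of_nat m \<noteq> (0 :: 'a)"
  shows "smooth_curve (curve m f) \<longleftrightarrow>
    m = 1 \<or> (\<forall>x. \<not> (poly (ac_poly f) x = 0 \<and> poly (pderiv (ac_poly f)) x = 0))"
proof -
  have m0: "m > 0" using m by (cases m) auto
  have mL: "of_nat m \<noteq> (0 :: 'a alg_closure)" using m to_ac_eq_0_iff[of "of_nat m :: 'a"] by simp
  have "map_poly pderiv (curve m f) = [:- pderiv f:]"
    using m0 by (intro poly_eqI)
      (auto simp: coeff_map_poly curve_def coeff_pCons pderiv_diff pderiv_minus split: nat.splits)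
  then have dx: "eval_xy (to_closure (map_poly pderiv (curve m f))) x y = - poly (pderiv (ac_poly f)) x" for x y
    by (simp add: eval_xy_def to_closure_def map_poly_pCons flip: ac_poly_pderiv)
       (simp add: poly_altdef coeff_map_poly sum_negf degree_map_poly)
  have "pderiv (curve m f) = monom (of_nat m) (m - 1)"
    by (simp add: curve_def pderiv_diff pderiv_monom pderiv_pCons)
  then have dy: "eval_xy (to_closure (pderiv (curve m f))) x y = of_nat m * y ^ (m - 1)" for x y
    by (simp add: eval_xy_def to_closure_def map_poly_monom poly_monom of_nat_poly map_poly_pCons
        flip: of_nat_mult)
  show ?thesis
  proof (cases "m = 1")
    case True
    then have "of_nat m * y ^ (m - 1) \<noteq> 0" for y :: "'a alg_closure" using mL by simp
    then show ?thesis using True unfolding smooth_curve_def dy by blast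
  next
    case False
    then have "m - 1 > 0" using m0 by simp
    then show ?thesis
      unfolding smooth_curve_def geom_zeros_curve using mL m0 False
      by (auto simp: dx dy) (metis power_eq_0_iff)+
  qed
qed

text \<open>A common divisor of f and f' that is a combination of both has no root in the closure,
  hence is constant.\<close>

lemma separable_iff_bezout:
  fixes f :: "'a::field poly"
  shows "(\<forall>x. \<not> (poly (ac_poly f) x = 0 \<and> poly (pderiv (ac_poly f)) x = 0)) \<longleftrightarrow>
    (\<exists>s t. s * f + t * pderiv f = 1)"
proof
  assume *: "\<forall>x. \<not> (poly (ac_poly f) x = 0 \<and> poly (pderiv (ac_poly f)) x = 0)"
  obtain e s t where e: "e dvd f" "e dvd pderiv f" and st: "e = s * f + t * pderiv f"
    by (rule poly_bezout)
  have "poly (ac_poly e) x \<noteq> 0" for x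
    using e * by (auto simp: ac_poly_mult simp flip: ac_poly_pderiv elim!: dvdE)
  then have "degree e = 0" "e \<noteq> 0"
    using alg_closed_imp_poly_has_root[of "ac_poly e"] by auto
  then obtain c where c: "e = [:c:]" "c \<noteq> 0" by (auto elim!: degree_eq_zeroE)
  have "([:inverse c:] * s) * f + ([:inverse c:] * t) * pderiv f = [:inverse c:] * e"
    unfolding st by (simp only: distrib_left mult.assoc)
  also have "\<dots> = 1" using c by (simp add: one_pCons)
  finally show "\<exists>s t. s * f + t * pderiv f = 1" by blast
next
  assume "\<exists>s t. s * f + t * pderiv f = 1"
  then obtain s t where "s * f + t * pderiv f = 1" by blast
  then have "ac_poly s * ac_poly f + ac_poly t * pderiv (ac_poly f) = 1"
    by (simp flip: ac_poly_mult ac_poly_add ac_poly_pderiv)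
  then have "poly (ac_poly s * ac_poly f + ac_poly t * pderiv (ac_poly f)) x = 1" for x by simp
  then show "\<forall>x. \<not> (poly (ac_poly f) x = 0 \<and> poly (pderiv (ac_poly f)) x = 0)"
    by (metis add_0 mult_zero_right poly_add poly_mult zero_neq_one)
qed

text \<open>A common root of f and f' over the closure makes their gcd over the finite field
  nonconstant, so some nonconstant h has h^2 dividing f. Either h is rootless, or the jet vanishes
  at a rational root of h.\<close>

lemma separable_iff_jet:
  fixes f :: "'a::{field,finite} poly"
  assumes f: "f \<noteq> 0"
  shows "(\<forall>x. \<not> (poly (ac_poly f) x = 0 \<and> poly (pderiv (ac_poly f)) x = 0)) \<longleftrightarrow>
    sqfree_off_points f \<and> (\<forall>c. jet f c \<noteq> 0)"
proof (intro iffI conjI allI)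
  assume *: "\<forall>x. \<not> (poly (ac_poly f) x = 0 \<and> poly (pderiv (ac_poly f)) x = 0)"
  show "sqfree_off_points f"
    unfolding sqfree_off_points_def
  proof (intro allI impI)
    fix h assume h: "rootless h \<and> h\<^sup>2 dvd f"
    then have "(ac_poly h)\<^sup>2 dvd ac_poly f"
      by (auto elim!: dvdE simp: ac_poly_mult ac_poly_power)
    then have "poly (ac_poly h) x \<noteq> 0" for x
      using * square_dvd_imp_pderiv_root by blast
    then show "degree h = 0" using alg_closed_imp_poly_has_root[of "ac_poly h"] by auto
  qed
  show "jet f c \<noteq> 0" for c
    using *[rule_format, of "to_ac c"] by (auto simp: jet_def zero_prod_def simp flip: ac_poly_pderiv)
next
  fix x
  assume *: "sqfree_off_points f \<and> (\<forall>c. jet f c \<noteq> 0)"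
  show "\<not> (poly (ac_poly f) x = 0 \<and> poly (pderiv (ac_poly f)) x = 0)"
  proof
    assume x: "poly (ac_poly f) x = 0 \<and> poly (pderiv (ac_poly f)) x = 0"
    obtain e s t where e: "e dvd f" "e dvd pderiv f" and st: "e = s * f + t * pderiv f"
      by (rule poly_bezout)
    have "poly (ac_poly e) x = 0"
      unfolding st using x by (simp add: ac_poly_add ac_poly_mult ac_poly_pderiv)
    moreover have "e \<noteq> 0" using e(1) f by auto
    ultimately have "degree e > 0"
      by (intro Nat.gr0I) (auto elim!: degree_eq_zeroE simp: map_poly_pCons)
    then obtain h where h: "degree h > 0" "h\<^sup>2 dvd f"
      using common_factor_pderiv_imp_square_factor[OF e] by blast
    then have "\<not> rootless h" using * by (auto simp: sqfree_off_points_def)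
    then obtain c where "poly h c = 0" by (auto simp: rootless_def)
    then have "jet f c = 0"
      using square_dvd_imp_pderiv_root[OF h(2)] by (simp add: jet_def zero_prod_def)
    with * show False by blast
  qed
qed

section \<open>Roots of unity and the fibre distribution\<close>

text \<open>With q - 1 = k l, X^(q-1) - 1 is X^k - 1 times a polynomial with at most k (l - 1)
  roots. All q - 1 nonzero elements are roots of the product, which leaves at least k for the first
  factor.\<close>

lemma card_roots_of_unity_finite_field:
  assumes "k dvd CARD('a::{field,finite}) - 1"
  shows "card {y :: 'a. y ^ k = 1} = k"
proof -
  define q where "q = CARD('a)"
  have q: "q \<ge> 2" using CARD_field_ge_2[where 'a='a] by (simp add: q_def)
  obtain l where l: "q - 1 = k * l" using assms by (auto simp: q_def)
  then have kl: "k > 0" "l > 0" using q by (auto intro!: Nat.gr0I)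
  define U where "U = {y :: 'a. y ^ k = 1}"
  define p :: "'a poly" where "p = (\<Sum>i<l. monom 1 (k * i))"
  define p1 :: "'a poly" where "p1 = monom 1 k - 1"
  have "coeff p 0 = (\<Sum>i<l. if i = 0 then 1 else 0)"
    unfolding p_def coeff_sum using kl by (intro sum.cong) auto
  then have p0: "p \<noteq> 0" using kl by auto
  have "degree p \<le> k * (l - 1)"
    unfolding p_def using kl by (intro degree_sum_le) (auto intro!: order_trans[OF degree_monom_le])
  then have card_p: "card {y. poly p y = 0} \<le> k * (l - 1)"
    using card_poly_roots_bound[OF p0] by linarith
  have "coeff p1 k = 1" using kl by (simp add: p1_def)
  then have p10: "p1 \<noteq> 0" by auto
  have "degree p1 \<le> k" unfolding p1_def by (intro degree_diff_le) (auto simp: degree_monom_le)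
  moreover have "U = {y. poly p1 y = 0}" by (simp add: U_def p1_def poly_monom)
  ultimately have le: "card U \<le> k" using card_poly_roots_bound[OF p10] by simp
  have "UNIV - {0} \<subseteq> U \<union> {y. poly p y = 0}"
  proof
    fix y :: 'a assume "y \<in> UNIV - {0}"
    then have "(y ^ k) ^ l = 1"
      using finite_field_power_CARD_minus_1[of y] l by (simp add: q_def power_mult)
    then have "(y ^ k - 1) * (\<Sum>i<l. (y ^ k) ^ i) = 0" by (simp flip: power_diff_1_eq)
    moreover have "poly p y = (\<Sum>i<l. (y ^ k) ^ i)" by (simp add: p_def poly_sum poly_monom power_mult)
    ultimately show "y \<in> U \<union> {y. poly p y = 0}" by (auto simp: U_def)
  qed
  then have "card (UNIV - {0 :: 'a}) \<le> card (U \<union> {y. poly p y = 0})" by (intro card_mono) auto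
  also have "\<dots> \<le> card U + k * (l - 1)" using card_Un_le[of U "{y. poly p y = 0}"] card_p by linarith
  finally have "k * l \<le> card U + k * (l - 1)" by (simp add: card_Diff_subset flip: l) (simp add: q_def)
  moreover have "k * l = k + k * (l - 1)" using kl by (cases l) auto
  ultimately show ?thesis using le by (simp add: U_def)
qed

text \<open>Since y^(q-1) = 1, Bezout reduces the exponent m to the gcd, which divides q -
  1.\<close>

lemma card_roots_of_unity:
  assumes "m > 0"
  shows "card {y :: 'a::{field,finite}. y ^ m = 1} = gcd m (CARD('a) - 1)"
proof -
  have "y ^ m = 1 \<longleftrightarrow> y ^ gcd m (CARD('a) - 1) = 1" for y :: 'a
  proof
    assume y: "y ^ m = 1"
    then have "y \<noteq> 0" using assms by (auto simp: power_0_left)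
    then have y': "y ^ (CARD('a) - 1) = 1" by (rule finite_field_power_CARD_minus_1)
    obtain u v where "m * u = (CARD('a) - 1) * v + gcd m (CARD('a) - 1)"
      using bezout_nat[of m "CARD('a) - 1"] assms by auto
    then have "(y ^ m) ^ u = (y ^ (CARD('a) - 1)) ^ v * y ^ gcd m (CARD('a) - 1)"
      by (simp only: power_mult[symmetric] power_add[symmetric])
    then show "y ^ gcd m (CARD('a) - 1) = 1" using y y' by simp
  next
    assume y: "y ^ gcd m (CARD('a) - 1) = 1"
    obtain u where "m = gcd m (CARD('a) - 1) * u" by (metis dvdE gcd_dvd1)
    then have "y ^ m = (y ^ gcd m (CARD('a) - 1)) ^ u" by (metis power_mult)
    with y show "y ^ m = 1" by simp
  qed
  then show ?thesis by (simp add: card_roots_of_unity_finite_field)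
qed

definition num_roots :: "nat \<Rightarrow> 'a::{field,finite} \<Rightarrow> nat" where
  "num_roots m v = card {y. y ^ m = v}"

lemma num_roots_0: "m > 0 \<Longrightarrow> num_roots m 0 = 1"
  by (simp add: num_roots_def)

text \<open>A nonempty fibre of y -> y^m above v is a coset of the m-th roots of unity.\<close>

lemma num_roots_nonzero:
  fixes v :: "'a::{field,finite}"
  assumes m: "m > 0" and v: "v \<noteq> 0"
  shows "num_roots m v \<in> {0, gcd m (CARD('a) - 1)}"
proof (cases "{y. y ^ m = v} = {}")
  case True
  then show ?thesis by (simp add: num_roots_def)
next
  case False
  then obtain y0 where y0: "y0 ^ m = v" by blast
  have y00: "y0 \<noteq> 0" using y0 v m by (auto simp: power_0_left)
  have "bij_betw (\<lambda>z. z * y0) {y. y ^ m = 1} {y. y ^ m = v}"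
    by (rule bij_betw_byWitness[where f' = "\<lambda>y. y / y0"])
       (use y0 y00 v in \<open>auto simp: power_mult_distrib power_divide\<close>)
  then have "card {y. y ^ m = v} = card {y :: 'a. y ^ m = 1}" by (metis bij_betw_same_card)
  then show ?thesis using m by (simp add: num_roots_def card_roots_of_unity)
qed

lemma sum_num_roots:
  assumes "m > 0"
  shows "(\<Sum>v\<in>UNIV - {0 :: 'a::{field,finite}}. num_roots m v) = CARD('a) - 1"
proof -
  have "(\<Sum>v\<in>UNIV - {0 :: 'a}. num_roots m v) = card (\<Union>v\<in>UNIV - {0 :: 'a}. {y. y ^ m = v})"
    unfolding num_roots_def by (rule card_UN_disjoint[symmetric]) auto
  also have "(\<Union>v\<in>UNIV - {0 :: 'a}. {y. y ^ m = v}) = UNIV - {0}" using assms by auto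
  finally show ?thesis by (simp add: card_Diff_subset)
qed

text \<open>Every nonzero y lies above exactly one nonzero value, and all nonempty fibres have the
  same size.\<close>

lemma card_powers:
  assumes m: "m > 0"
  shows "card {v :: 'a::{field,finite}. v \<noteq> 0 \<and> num_roots m v \<noteq> 0} * gcd m (CARD('a) - 1) = CARD('a) - 1"
proof -
  let ?P = "{v :: 'a. v \<noteq> 0 \<and> num_roots m v \<noteq> 0}"
  have "CARD('a) - 1 = (\<Sum>v\<in>?P. num_roots m v)"
    unfolding sum_num_roots[OF m, where 'a='a, symmetric] by (rule sum.mono_neutral_right) auto
  also have "\<dots> = (\<Sum>v\<in>?P. gcd m (CARD('a) - 1))"
  proof (intro sum.cong refl)
    fix v assume "v \<in> ?P"
    then show "num_roots m v = gcd m (CARD('a) - 1)" using num_roots_nonzero[OF m, of v] by auto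
  qed
  finally show ?thesis by simp
qed

lemma fibre_pmf_eq_map_pmf:
  assumes m: "m > 0"
  shows "fibre_pmf (CARD('a)) m =
    map_pmf (\<lambda>z. num_roots m (fst z)) (pmf_of_set (UNIV - {0 :: 'a::{field,finite} \<times> 'a}))"
proof (rule pmf_eqI)
  fix i :: nat
  define q where "q = real CARD('a)"
  define r where "r = gcd m (CARD('a) - 1)"
  let ?V = "UNIV - {0 :: 'a \<times> 'a}"
  have q2: "q \<ge> 2" using CARD_field_ge_2[where 'a='a] by (simp add: q_def)
  have r: "r > 0" using m by (simp add: r_def)
  define P where "P = {v :: 'a. v \<noteq> 0 \<and> num_roots m v \<noteq> 0}"
  have P_nr: "num_roots m v = r" if "v \<in> P" for v
    using num_roots_nonzero[OF m, of v] that by (auto simp: P_def r_def)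
  have cardP: "real (card P) * real r = q - 1"
  proof -
    have "card P * r = CARD('a) - 1"
      unfolding P_def r_def by (rule card_powers[OF m])
    then have "real (card P * r) = real (CARD('a) - 1)" by simp
    then show ?thesis using CARD_field_ge_2[where 'a='a] by (simp add: q_def of_nat_diff)
  qed
  define N where "N = {v :: 'a. v \<noteq> 0 \<and> num_roots m v = 0}"
  have "CARD('a) = Suc (card P + card N)"
  proof -
    have "(UNIV :: 'a set) = insert 0 (P \<union> N)" by (auto simp: P_def N_def)
    moreover have "card (insert 0 (P \<union> N)) = Suc (card P + card N)"
      by (subst card_insert_disjoint) (auto simp: P_def N_def intro!: card_Un_disjoint)
    ultimately show ?thesis by simp
  qed
  then have cardN: "real (card N) = q - 1 - real (card P)" by (simp add: q_def)
  \<comment> \<open>One set per entry of the list in \<open>fibre_pmf\<close>. The conditions on i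
    are independent of each other, so for r = 1 the contributions of \<open>A1\<close> and
    \<open>A2\<close> add up, as in \<open>pmf_of_list\<close>.\<close>
  define A1 where "A1 = (if i = 1 then {0 :: 'a} \<times> (UNIV - {0 :: 'a}) else {})"
  define A2 where "A2 = (if i = r then P \<times> (UNIV :: 'a set) else {})"
  define A3 where "A3 = (if i = 0 then N \<times> (UNIV :: 'a set) else {})"
  have eq: "{z \<in> ?V. num_roots m (fst z) = i} = A1 \<union> A2 \<union> A3"
  proof (rule Set.set_eqI)
    fix z :: "'a \<times> 'a"
    obtain v w where z: "z = (v, w)" by (cases z)
    have mem: "z \<in> A1 \<longleftrightarrow> i = 1 \<and> v = 0 \<and> w \<noteq> 0" "z \<in> A2 \<longleftrightarrow> i = r \<and> v \<in> P"
      "z \<in> A3 \<longleftrightarrow> i = 0 \<and> v \<in> N"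
      by (simp_all add: A1_def A2_def A3_def z)
    have mem': "z \<in> {z \<in> ?V. num_roots m (fst z) = i} \<longleftrightarrow> (v \<noteq> 0 \<or> w \<noteq> 0) \<and> num_roots m v = i"
      by (auto simp: z zero_prod_def)
    have "v = 0 \<or> v \<in> P \<or> v \<in> N"
      by (cases "v = 0"; cases "num_roots m v = 0"; simp add: P_def N_def)
    then consider "v = 0" | "v \<in> P" | "v \<in> N" by blast
    then show "z \<in> {z \<in> ?V. num_roots m (fst z) = i} \<longleftrightarrow> z \<in> A1 \<union> A2 \<union> A3"
      unfolding mem' Un_iff mem
    proof cases
      case 1
      then have "v \<notin> P" "v \<notin> N" by (simp_all add: P_def N_def)
      moreover have "num_roots m v = 1" unfolding 1 by (rule num_roots_0[OF m])
      ultimately show "(v \<noteq> 0 \<or> w \<noteq> 0) \<and> num_roots m v = i \<longleftrightarrow>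
        (i = 1 \<and> v = 0 \<and> w \<noteq> 0 \<or> i = r \<and> v \<in> P) \<or> i = 0 \<and> v \<in> N" using 1 by metis
    next
      case 2
      then have "v \<noteq> 0" "v \<notin> N" by (simp_all add: P_def N_def)
      then show "(v \<noteq> 0 \<or> w \<noteq> 0) \<and> num_roots m v = i \<longleftrightarrow>
        (i = 1 \<and> v = 0 \<and> w \<noteq> 0 \<or> i = r \<and> v \<in> P) \<or> i = 0 \<and> v \<in> N" using P_nr[OF 2] 2 by metis
    next
      case 3
      then have "v \<noteq> 0" "v \<notin> P" "num_roots m v = 0" by (simp_all add: P_def N_def)
      then show "(v \<noteq> 0 \<or> w \<noteq> 0) \<and> num_roots m v = i \<longleftrightarrow>
        (i = 1 \<and> v = 0 \<and> w \<noteq> 0 \<or> i = r \<and> v \<in> P) \<or> i = 0 \<and> v \<in> N" using 3 by metis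
    qed
  qed
  have disj: "A1 \<inter> A2 = {}" "(A1 \<union> A2) \<inter> A3 = {}"
    by (auto simp: A1_def A2_def A3_def P_def N_def split: if_splits)
  have "real (card {z \<in> ?V. num_roots m (fst z) = i}) = real (card A1) + real (card A2) + real (card A3)"
    unfolding eq using disj by (simp add: card_Un_disjoint)
  also have "real (card A1) = (if i = 1 then q - 1 else 0)"
    using q2 by (simp add: A1_def card_cartesian_product card_Diff_subset q_def of_nat_diff)
  also have "real (card A2) = (if i = r then card P * q else 0)"
    by (simp add: A2_def card_cartesian_product q_def)
  also have "real (card A3) = (if i = 0 then card N * q else 0)"
    by (simp add: A3_def card_cartesian_product q_def)
  finally have num: "real (card {z \<in> ?V. num_roots m (fst z) = i}) =
     (if i = 1 then q - 1 else 0) + (if i = r then card P * q else 0) + (if i = 0 then card N * q else 0)" .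
  have denom: "real (card ?V) = q\<^sup>2 - 1"
    by (simp add: card_Diff_subset q_def power2_eq_square of_nat_diff)
  have rhs: "pmf (map_pmf (\<lambda>z. num_roots m (fst z)) (pmf_of_set ?V)) i =
     ((if i = 1 then q - 1 else 0) + (if i = r then card P * q else 0) + (if i = 0 then card N * q else 0)) / (q\<^sup>2 - 1)"
  proof -
    have "(1, 0) \<in> ?V" by (simp add: zero_prod_def)
    then have "?V \<noteq> {}" by blast
    moreover have "?V \<inter> (\<lambda>z. num_roots m (fst z)) -` {i} = {z \<in> ?V. num_roots m (fst z) = i}" by auto
    ultimately show ?thesis unfolding num[symmetric] denom[symmetric]
      by (simp add: pmf_map measure_pmf_of_set del: card_Diff_insert)
  qed
  define s where "s = inverse q"
  have lhs: "pmf (fibre_pmf (CARD('a)) m) i =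
     (if i = 0 then (1 - 1 / real r) * (1 / (1 + s)) else 0) + (if i = 1 then s / (1 + s) else 0) +
     (if i = r then 1 / real r * (1 / (1 + s)) else 0)"
    using fibre_pmf_wf[OF m, of "CARD('a)"]
    by (simp add: fibre_pmf_def Let_def pmf_pmf_of_list r_def s_def q_def)
  have qq: "q\<^sup>2 - 1 = (q - 1) * (q + 1)" by (simp add: power2_eq_square algebra_simps)
  have cP: "real (card P) = (q - 1) / r" using cardP r by (simp add: field_simps)
  have 1: "1 / (1 + s) = q / (q + 1)" "s / (1 + s) = 1 / (q + 1)"
    using q2 by (simp_all add: s_def field_simps)
  have 2: "(q - 1) / (q\<^sup>2 - 1) = 1 / (q + 1)" using q2 by (simp add: qq)
  have 3: "card P * q / (q\<^sup>2 - 1) = 1 / r * (q / (q + 1))" using q2 by (simp add: qq cP)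
  have 4: "card N * q / (q\<^sup>2 - 1) = (1 - 1 / r) * (q / (q + 1))"
  proof -
    have "real (card N) = (q - 1) * (1 - 1 / r)" by (simp add: cardN cP algebra_simps)
    then show ?thesis using q2 by (simp add: qq)
  qed
  show "pmf (fibre_pmf (CARD('a)) m) i = pmf (map_pmf (\<lambda>z. num_roots m (fst z)) (pmf_of_set ?V)) i"
    unfolding lhs rhs 1 add_divide_distrib using 2 3 4 by simp
qed

text \<open>By independence the joint law is the product of the marginal laws, so given variables
  may be replaced by the coordinates of any concrete model with the same marginals.\<close>

lemma sum_distribution_unique:
  fixes Y :: "nat \<Rightarrow> 'b \<Rightarrow> nat" and Y' :: "nat \<Rightarrow> 'c \<Rightarrow> nat"
  assumes "prob_space M" "prob_space M'" "finite I" "I \<noteq> {}"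
    and "prob_space.indep_vars M (\<lambda>_. count_space UNIV) Y I"
    and "prob_space.indep_vars M' (\<lambda>_. count_space UNIV) Y' I"
    and "\<And>j. j \<in> I \<Longrightarrow> distr M (count_space UNIV) (Y j) = distr M' (count_space UNIV) (Y' j)"
  shows "measure M {\<omega> \<in> space M. int (\<Sum>j\<in>I. Y j \<omega>) = k} =
    measure M' {\<omega> \<in> space M'. int (\<Sum>j\<in>I. Y' j \<omega>) = k}"
proof -
  define P where "P = (\<Pi>\<^sub>M j\<in>I. (count_space UNIV :: nat measure))"
  define S where "S = {y \<in> space P. int (\<Sum>j\<in>I. y j) = k}"
  \<comment> \<open>Measurability of the event is obtained from a sum of real-valued functions and
    then carried back to integers.\<close>
  have "(\<lambda>y. \<Sum>j\<in>I. real (y j)) \<in> borel_measurable P"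
    unfolding P_def by (intro borel_measurable_sum) measurable
  then have "{y \<in> space P. (\<Sum>j\<in>I. real (y j)) = real_of_int k} \<in> sets P"
    by measurable
  moreover have "(\<Sum>j\<in>I. real (y j)) = real_of_int k \<longleftrightarrow> int (\<Sum>j\<in>I. y j) = k" for y
    by (metis of_int_eq_iff of_int_of_nat_eq of_nat_sum)
  ultimately have S: "S \<in> sets P" by (simp add: S_def)
  have key: "measure N {\<omega> \<in> space N. int (\<Sum>j\<in>I. Z j \<omega>) = k} =
      measure (\<Pi>\<^sub>M j\<in>I. distr N (count_space UNIV) (Z j)) S"
    if N: "prob_space N" and ind: "prob_space.indep_vars N (\<lambda>_. count_space UNIV) Z I"
    for N :: "'d measure" and Z :: "nat \<Rightarrow> 'd \<Rightarrow> nat"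
  proof -
    interpret prob_space N by (rule N)
    have rv: "random_variable (count_space UNIV) (Z j)" if "j \<in> I" for j
      using ind that by (auto simp: indep_vars_def)
    have meas: "(\<lambda>\<omega>. \<lambda>j\<in>I. Z j \<omega>) \<in> measurable N P"
      unfolding P_def using rv by (intro measurable_restrict)
    have "measure (\<Pi>\<^sub>M j\<in>I. distr N (count_space UNIV) (Z j)) S =
        measure (distr N P (\<lambda>\<omega>. \<lambda>j\<in>I. Z j \<omega>)) S"
      using indep_vars_iff_distr_eq_PiM'[OF \<open>I \<noteq> {}\<close> rv] ind unfolding P_def by simp
    also have "\<dots> = measure N ((\<lambda>\<omega>. \<lambda>j\<in>I. Z j \<omega>) -` S \<inter> space N)"
      by (rule measure_distr[OF meas S])
    also have "(\<lambda>\<omega>. \<lambda>j\<in>I. Z j \<omega>) -` S \<inter> space N = {\<omega> \<in> space N. int (\<Sum>j\<in>I. Z j \<omega>) = k}"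
      by (auto simp: S_def P_def space_PiM)
    finally show ?thesis by simp
  qed
  have "(\<Pi>\<^sub>M j\<in>I. distr M (count_space UNIV) (Y j)) = (\<Pi>\<^sub>M j\<in>I. distr M' (count_space UNIV) (Y' j))"
    using assms(7) by (intro PiM_cong) auto
  then show ?thesis using key[OF assms(1,5)] key[OF assms(2,6)] by simp
qed

definition jets_nonzero :: "('a::{field,finite} \<Rightarrow> 'a \<times> 'a) set" where
  "jets_nonzero = {J. \<forall>c. J c \<noteq> 0}"

definition jet_num_points :: "nat \<Rightarrow> ('a::{field,finite} \<Rightarrow> 'a \<times> 'a) \<Rightarrow> nat" where
  "jet_num_points m J = (\<Sum>c\<in>UNIV. num_roots m (fst (J c)))"

lemma jets_nonzero_not_empty: "jets_nonzero \<noteq> ({} :: ('a::{field,finite} \<Rightarrow> 'a \<times> 'a) set)"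
proof -
  have "(\<lambda>_. (1, 0)) \<in> (jets_nonzero :: ('a \<Rightarrow> 'a \<times> 'a) set)"
    by (simp add: jets_nonzero_def zero_prod_def)
  then show ?thesis by blast
qed

text \<open>The concrete model is the uniform distribution on families of q nonzero pairs: it is the
  product of uniform ones, so its coordinates are independent, and its probabilities are quotients
  of cardinalities.\<close>

lemma fibre_sum_distribution:
  fixes M :: "'b measure" and Y :: "nat \<Rightarrow> 'b \<Rightarrow> nat" and k :: int
  assumes m: "m > 0" and M: "prob_space M"
    and indep: "prob_space.indep_vars M (\<lambda>_. count_space UNIV) Y {1..CARD('a::{field,finite})}"
    and distr: "\<And>j. j \<in> {1..CARD('a)} \<Longrightarrow>
      distr M (count_space UNIV) (Y j) = measure_pmf (fibre_pmf (CARD('a)) m)"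
  shows "measure M {\<omega> \<in> space M. int (\<Sum>j\<in>{1..CARD('a)}. Y j \<omega>) = k} =
    real (card {J :: 'a \<Rightarrow> 'a \<times> 'a. J \<in> jets_nonzero \<and> int (jet_num_points m J) = k}) /
    real (card (jets_nonzero :: ('a \<Rightarrow> 'a \<times> 'a) set))"
proof -
  define I where "I = {1..CARD('a)}"
  have I: "finite I" "I \<noteq> {}" by (auto simp: I_def Suc_le_eq)
  define V where "V = UNIV - {0 :: 'a \<times> 'a}"
  have V: "finite V" "V \<noteq> {}"
  proof -
    have "(1, 0) \<in> V" by (simp add: V_def zero_prod_def)
    then show "V \<noteq> {}" by blast
  qed simp
  define W where "W = PiE_dflt I 0 (\<lambda>_. V)"
  have W: "finite W" "W \<noteq> {}" using I V by (auto simp: W_def)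
  define p where "p = Pi_pmf I 0 (\<lambda>_. pmf_of_set V)"
  have pW: "p = pmf_of_set W" unfolding p_def W_def using I V by (intro Pi_pmf_of_set) auto
  define g where "g = (\<lambda>z :: 'a \<times> 'a. num_roots m (fst z))"
  have ind: "prob_space.indep_vars (measure_pmf p) (\<lambda>_. count_space UNIV) (\<lambda>j f. g (f j)) I"
    unfolding p_def
    by (intro prob_space.indep_vars_compose2[OF _ indep_vars_Pi_pmf[OF I(1)]])
       (auto simp: prob_space_measure_pmf)
  have "distr (measure_pmf p) (count_space UNIV) (\<lambda>f. g (f j)) = measure_pmf (fibre_pmf (CARD('a)) m)"
    if "j \<in> I" for j
  proof -
    have "map_pmf (\<lambda>f. g (f j)) p = map_pmf g (map_pmf (\<lambda>f. f j) p)" by (simp add: pmf.map_comp o_def)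
    also have "map_pmf (\<lambda>f. f j) p = pmf_of_set V"
      unfolding p_def using I that by (subst Pi_pmf_component) auto
    also have "map_pmf g (pmf_of_set V) = fibre_pmf (CARD('a)) m"
      unfolding g_def V_def by (rule fibre_pmf_eq_map_pmf[OF m, symmetric])
    finally show ?thesis by (simp add: map_pmf_rep_eq[symmetric])
  qed
  then have "measure M {\<omega> \<in> space M. int (\<Sum>j\<in>I. Y j \<omega>) = k} =
      measure (measure_pmf p) {f \<in> space (measure_pmf p). int (\<Sum>j\<in>I. g (f j)) = k}"
    using indep ind distr M I unfolding I_def
    by (intro sum_distribution_unique) (auto simp: prob_space_measure_pmf)
  also have "\<dots> = card (W \<inter> {f. int (\<Sum>j\<in>I. g (f j)) = k}) / card W"
    unfolding pW using W by (simp add: measure_pmf_of_set)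
  also have "W \<inter> {f. int (\<Sum>j\<in>I. g (f j)) = k} = {f \<in> W. int (\<Sum>j\<in>I. g (f j)) = k}" by blast
  finally have prob: "measure M {\<omega> \<in> space M. int (\<Sum>j\<in>I. Y j \<omega>) = k} =
      card {f \<in> W. int (\<Sum>j\<in>I. g (f j)) = k} / card W" .
  have cards: "card {f \<in> W. int (\<Sum>j\<in>I. g (f j)) = k} =
      card {J :: 'a \<Rightarrow> 'a \<times> 'a. J \<in> jets_nonzero \<and> int (jet_num_points m J) = k} \<and>
      card W = card (jets_nonzero :: ('a \<Rightarrow> 'a \<times> 'a) set)"
  proof -
    \<comment> \<open>An arbitrary numbering of the field elements turns families indexed by 1, ...,
      q into jets. The default 0 outside I makes \<open>\<psi>\<close> inverse to
      \<open>\<phi>\<close> on W.\<close>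
    have "\<exists>b. bij_betw b I (UNIV :: 'a set)"
      by (rule finite_same_card_bij) (simp_all add: I_def)
    then obtain b where b: "bij_betw b I (UNIV :: 'a set)" ..
    define b' where "b' = inv_into I b"
    have b': "b (b' c) = c" "b' c \<in> I" for c
      using b unfolding b'_def
      by (auto simp: bij_betw_def f_inv_into_f inv_into_into)
    have b'': "b' (b j) = j" if "j \<in> I" for j
      using b that by (simp add: b'_def bij_betw_def)
    define \<phi> where "\<phi> = (\<lambda>f :: nat \<Rightarrow> 'a \<times> 'a. f \<circ> b')"
    define \<psi> where "\<psi> = (\<lambda>J :: 'a \<Rightarrow> 'a \<times> 'a. \<lambda>j. if j \<in> I then J (b j) else 0)"
    have \<phi>W: "\<phi> f \<in> jets_nonzero" if "f \<in> W" for f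
      using that b' by (auto simp: \<phi>_def jets_nonzero_def W_def PiE_dflt_def V_def)
    have \<psi>W: "\<psi> J \<in> W" if "J \<in> jets_nonzero" for J
      using that by (auto simp: \<psi>_def jets_nonzero_def W_def PiE_dflt_def V_def)
    have \<psi>\<phi>: "\<psi> (\<phi> f) = f" if "f \<in> W" for f
      using that b'' by (auto simp: \<phi>_def \<psi>_def W_def PiE_dflt_def fun_eq_iff)
    have \<phi>\<psi>: "\<phi> (\<psi> J) = J" for J
      using b' by (auto simp: \<phi>_def \<psi>_def fun_eq_iff)
    have sum: "(\<Sum>j\<in>I. g (f j)) = jet_num_points m (\<phi> f)" if "f \<in> W" for f
    proof -
      have "jet_num_points m (\<phi> f) = (\<Sum>j\<in>I. num_roots m (fst (\<phi> f (b j))))"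
        unfolding jet_num_points_def by (rule sum.reindex_bij_betw[OF b, symmetric])
      also have "\<dots> = (\<Sum>j\<in>I. g (f j))"
        by (intro sum.cong) (simp_all add: \<phi>_def b'' g_def)
      finally show ?thesis by simp
    qed
    have "bij_betw \<phi> W jets_nonzero"
      by (rule bij_betw_byWitness[where f' = \<psi>]) (use \<phi>W \<psi>W \<psi>\<phi> \<phi>\<psi> in auto)
    moreover have "{f \<in> W. int (\<Sum>j\<in>I. g (f j)) = k} = {f \<in> W. int (jet_num_points m (\<phi> f)) = k}"
      by (intro Collect_cong conj_cong refl) (simp only: sum)
    moreover have "bij_betw \<phi> {f \<in> W. int (jet_num_points m (\<phi> f)) = k}
        {J. J \<in> jets_nonzero \<and> int (jet_num_points m J) = k}"
      by (rule bij_betw_byWitness[where f' = \<psi>])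
         (use \<phi>W \<psi>W \<psi>\<phi> \<phi>\<psi> in auto)
    ultimately show ?thesis by (simp only: bij_betw_same_card simp_thms)
  qed
  show ?thesis using prob unfolding cards[THEN conjunct1] cards[THEN conjunct2] unfolding I_def .
qed

section \<open>The limit\<close>

lemma num_points_eq_jet_num_points: "num_points m f = jet_num_points m (jet f)"
proof -
  have "{(x :: 'a, y :: 'a). y ^ m = poly f x} = (SIGMA x:UNIV. {y. y ^ m = poly f x})" by auto
  then show ?thesis
    by (simp add: num_points_def jet_num_points_def num_roots_def jet_def)
qed

lemma smooth_curve_iff_jet:
  fixes f :: "'a::{field,finite} poly"
  assumes "of_nat m \<noteq> (0 :: 'a)" "m \<noteq> 1" "f \<noteq> 0"
  shows "smooth_curve (curve m f) \<longleftrightarrow> sqfree_off_points f \<and> jet f \<in> jets_nonzero"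
  using assms smooth_curve_curve_iff[of m f] separable_iff_jet[of f] by (simp add: jets_nonzero_def)

lemma smooth_curve_imp_irreducible:
  fixes f :: "'a::field poly"
  assumes m: "of_nat m \<noteq> (0 :: 'a)" and "degree f > 0" and "smooth_curve (curve m f)"
  shows "irreducible_curve (curve m f)" "geom_irreducible_curve (curve m f)"
proof -
  have "m = 1 \<or> (\<exists>s t. s * f + t * pderiv f = 1)"
    using smooth_curve_curve_iff[OF m, of f] separable_iff_bezout[of f] assms(3) by simp
  then obtain s t where "m = 1 \<or> s * f + t * pderiv f = 1" by blast
  with assms(1,2) show "irreducible_curve (curve m f)" "geom_irreducible_curve (curve m f)"
    by (blast intro: irreducible_curve_curve geom_irreducible_curve_curve)+
qed

lemma smooth_ratio_tendsto:
  fixes m :: nat and k :: int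
  assumes m: "of_nat m \<noteq> (0 :: 'a::{field,finite})"
  shows "(\<lambda>d. real (card {f :: 'a poly. f \<in> polys_of_degree d \<and>
               smooth_curve (curve m f) \<and> int (num_points m f) = k}) /
           real (card {f :: 'a poly. f \<in> polys_of_degree d \<and> smooth_curve (curve m f)}))
        \<longlonglongrightarrow> real (card {J :: 'a \<Rightarrow> 'a \<times> 'a. J \<in> jets_nonzero \<and> int (jet_num_points m J) = k}) /
          real (card (jets_nonzero :: ('a \<Rightarrow> 'a \<times> 'a) set))"
proof (cases "m = 1")
  case True
  have pts: "jet_num_points m J = CARD('a)" for J :: "'a \<Rightarrow> 'a \<times> 'a"
    by (simp add: jet_num_points_def num_roots_def True)
  have smooth: "smooth_curve (curve m f)" for f :: "'a poly"
    using smooth_curve_curve_iff[OF m] True by blast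
  \<comment> \<open>For m = 1 every f counts and has exactly q points. A nonzero denominator ensures
    that the ratio for k = q is 1 and not 0 / 0 = 0.\<close>
  have "card (polys_of_degree d :: 'a poly set) \<noteq> 0" for d
    using CARD_field_ge_2[where 'a='a] by (simp add: card_polys_of_degree)
  then show ?thesis
    by (cases "int CARD('a) = k")
       (simp_all add: num_points_eq_jet_num_points pts smooth jets_nonzero_not_empty del: card_eq_0_iff)
next
  case False
  define B where "B = (jets_nonzero :: ('a \<Rightarrow> 'a \<times> 'a) set)"
  define A where "A = {J. J \<in> B \<and> int (jet_num_points m J) = k}"
  have count: "card {f. f \<in> polys_of_degree d \<and> sqfree_off_points f \<and> jet f \<in> S} =
      (\<Sum>J\<in>S. sqfree_count d J)" for d and S :: "('a \<Rightarrow> 'a \<times> 'a) set"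
  proof -
    have "{f. f \<in> polys_of_degree d \<and> sqfree_off_points f \<and> jet f \<in> S} =
      (\<Union>J\<in>S. {f \<in> polys_of_degree d. jet f = J \<and> sqfree_off_points f})" by auto
    also have "card \<dots> = (\<Sum>J\<in>S. sqfree_count d J)"
      unfolding sqfree_count_def by (rule card_UN_disjoint) auto
    finally show ?thesis .
  qed
  have smooth: "f \<in> polys_of_degree d \<and> smooth_curve (curve m f) \<longleftrightarrow>
      f \<in> polys_of_degree d \<and> sqfree_off_points f \<and> jet f \<in> B" for d and f :: "'a poly"
    using smooth_curve_iff_jet[OF m False, of f] by (auto simp: polys_of_degree_def B_def)
  have num: "card {f :: 'a poly. f \<in> polys_of_degree d \<and> smooth_curve (curve m f) \<and>
      int (num_points m f) = k} = (\<Sum>J\<in>A. sqfree_count d J)" for d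
    unfolding count[symmetric] A_def num_points_eq_jet_num_points
    by (intro arg_cong[of _ _ card] Collect_cong) (use smooth in blast)
  have den: "card {f :: 'a poly. f \<in> polys_of_degree d \<and> smooth_curve (curve m f)} =
      (\<Sum>J\<in>B. sqfree_count d J)" for d
    unfolding count[symmetric] smooth ..
  have "B \<noteq> {}" unfolding B_def by (rule jets_nonzero_not_empty)
  then show ?thesis
    unfolding num den of_nat_sum B_def[symmetric] A_def[symmetric] by (rule sqfree_count_ratio_tendsto)
qed

text \<open>Summing all x + 1 and all x gives the same value, so q is zero in the field and the
  characteristic divides q.\<close>

lemma of_nat_neq_0_if_coprime_CARD:
  assumes "coprime (CARD('a)) m"
  shows "of_nat m \<noteq> (0 :: 'a::{field,finite})"
proof
  assume "of_nat m = (0 :: 'a)"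
  then have "CHAR('a) dvd m" by (simp add: of_nat_eq_0_iff_char_dvd)
  moreover have "(\<Sum>x\<in>UNIV. x + 1) = (\<Sum>x\<in>UNIV. x :: 'a)"
    by (rule sum.reindex_bij_betw[where h = "\<lambda>x. x + 1"]) (rule bij_betw_byWitness[where f' = "\<lambda>x. x - 1"], auto)
  then have "of_nat (CARD('a)) = (0 :: 'a)" by (simp add: sum.distrib)
  then have "CHAR('a) dvd CARD('a)" by (simp add: of_nat_eq_0_iff_char_dvd)
  ultimately have "CHAR('a) dvd 1" using assms by (metis coprime_common_divisor)
  with prime_CHAR_finite_field[where 'a='a] show False by auto
qed

theorem theorem1p1:
  fixes q m :: nat and k :: int
    and M :: "'b measure" and Y :: "nat \<Rightarrow> 'b \<Rightarrow> nat"
  assumes q: "q = CARD('a::{field,finite})"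
    and m: "m > 0" "coprime q m"
    and M: "prob_space M"
    and indep: "prob_space.indep_vars M (\<lambda>_. count_space UNIV) Y {1..q}"
    and distr: "\<And>j. j \<in> {1..q} \<Longrightarrow>
                  distr M (count_space UNIV) (Y j) = measure_pmf (fibre_pmf q m)"
  shows
    "(\<lambda>d. real (card {f :: 'a poly. f \<in> polys_of_degree d \<and>
               smooth_curve (curve m f) \<and> int (num_points m f) = k}) /
           real (card {f :: 'a poly. f \<in> polys_of_degree d \<and>
               smooth_curve (curve m f)}))
        \<longlonglongrightarrow> measure M {\<omega> \<in> space M. int (\<Sum>j\<in>{1..q}. Y j \<omega>) = k}
     \<and>
     (\<lambda>d. real (card {f :: 'a poly. f \<in> polys_of_degree d \<and>
               smooth_curve (curve m f) \<and> irreducible_curve (curve m f) \<and>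
               int (num_points m f) = k}) /
           real (card {f :: 'a poly. f \<in> polys_of_degree d \<and>
               smooth_curve (curve m f) \<and> irreducible_curve (curve m f)}))
        \<longlonglongrightarrow> measure M {\<omega> \<in> space M. int (\<Sum>j\<in>{1..q}. Y j \<omega>) = k}
     \<and>
     (\<lambda>d. real (card {f :: 'a poly. f \<in> polys_of_degree d \<and>
               smooth_curve (curve m f) \<and> geom_irreducible_curve (curve m f) \<and>
               int (num_points m f) = k}) /
           real (card {f :: 'a poly. f \<in> polys_of_degree d \<and>
               smooth_curve (curve m f) \<and> geom_irreducible_curve (curve m f)}))
        \<longlonglongrightarrow> measure M {\<omega> \<in> space M. int (\<Sum>j\<in>{1..q}. Y j \<omega>) = k}"
proof -
  let ?S = "\<lambda>Q d. {f :: 'a poly. f \<in> polys_of_degree d \<and> smooth_curve (curve m f) \<and>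
    Q f \<and> int (num_points m f) = k}"
  let ?T = "\<lambda>Q d. {f :: 'a poly. f \<in> polys_of_degree d \<and> smooth_curve (curve m f) \<and> Q f}"
  let ?p = "measure M {\<omega> \<in> space M. int (\<Sum>j\<in>{1..q}. Y j \<omega>) = k}"
  have m': "of_nat m \<noteq> (0 :: 'a)" using m(2) unfolding q by (rule of_nat_neq_0_if_coprime_CARD)
  have p: "?p = real (card {J :: 'a \<Rightarrow> 'a \<times> 'a. J \<in> jets_nonzero \<and> int (jet_num_points m J) = k}) /
      real (card (jets_nonzero :: ('a \<Rightarrow> 'a \<times> 'a) set))"
    using indep distr unfolding q by (rule fibre_sum_distribution[OF m(1) M])
  have lim: "(\<lambda>d. real (card {f :: 'a poly. f \<in> polys_of_degree d \<and>
               smooth_curve (curve m f) \<and> int (num_points m f) = k}) /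
           real (card {f :: 'a poly. f \<in> polys_of_degree d \<and> smooth_curve (curve m f)})) \<longlonglongrightarrow> ?p"
    unfolding p using m' by (rule smooth_ratio_tendsto)
  have restrict: "(\<lambda>d. real (card (?S Q d)) / real (card (?T Q d))) \<longlonglongrightarrow> ?p"
    if Q: "\<And>f :: 'a poly. degree f > 0 \<Longrightarrow> smooth_curve (curve m f) \<Longrightarrow> Q f" for Q
  proof (rule Lim_transform_eventually[OF lim], rule eventually_mono[OF eventually_gt_at_top[of 0]])
    \<comment> \<open>For d = 0 the restricted sets may differ: y^m = c with c nonzero can be smooth
      and yet split. The limit ignores this degree.\<close>
    fix d :: nat assume "d > 0"
    then have "Q f" if "f \<in> polys_of_degree d" "smooth_curve (curve m f)" for f
      using that Q[of f] by (simp add: polys_of_degree_def)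
    then have "?S Q d = {f. f \<in> polys_of_degree d \<and> smooth_curve (curve m f) \<and> int (num_points m f) = k}"
      "?T Q d = {f. f \<in> polys_of_degree d \<and> smooth_curve (curve m f)}"
      by blast+
    then show "real (card {f :: 'a poly. f \<in> polys_of_degree d \<and>
               smooth_curve (curve m f) \<and> int (num_points m f) = k}) /
           real (card {f :: 'a poly. f \<in> polys_of_degree d \<and> smooth_curve (curve m f)}) =
        real (card (?S Q d)) / real (card (?T Q d))" by simp
  qed
  show ?thesis
    using lim restrict[of "\<lambda>f. irreducible_curve (curve m f)"]
      restrict[of "\<lambda>f. geom_irreducible_curve (curve m f)"] smooth_curve_imp_irreducible[OF m']
    by blast
qed

end
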